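(* Let $n\ge 1$, $n<p<\infty$, and let $\rho$ be an admissible measure on $\mathbb{R}^n$. Let $S\in\mathcal{S}(n)$, set $\mu=S_\#\rho$, and let $u\in\mathcal{D}^{1,p}(\mathbb{R}^n)$. The following are equivalent. (i) $u$ is an extremal of the generalized Morrey inequality $[w]_\rho\le C_*\|Dw\|_p$ with $$[u]_\rho=\frac{\left|\int_{\mathbb{R}^n}u(x)\,d\mu(x)\right|}{\left|\int_{\mathbb{R}^n}x\,d\mu(x)\right|^{1-n/p}}.$$ (ii) There is $c\in\mathbb{R}$ for which $-\Delta_p u=c\mu$ in $\mathbb{R}^n$, that is, $$\int_{\mathbb{R}^n}|Du|^{p-2}Du\cdot Dv\,dx=c\int_{\mathbb{R}^n}v\,d\mu\quad\text{for all }v\in\mathcal{D}^{1,p}(\mathbb{R}^n).$$ (iii) For each $v\in\mathcal{D}^{1,p}(\mathbb{R}^n)$ with $\int_{\mathbb{R}^n}v\,d\mu=\int_{\mathbb{R}^n}u\,d\mu$, one has $\|Du\|_p\le\|Dv\|_p$.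
   Context: $\mathcal{D}^{1,p}(\mathbb{R}^n)$ is the space of $u\in L^1_{\rm loc}(\mathbb{R}^n)$ whose weak partial derivatives $u_{x_i}$, $i=1,\dots,n$, all belong to $L^p(\mathbb{R}^n)$. Since $p>n$, each $u$ is identified with its $(1-n/p)$-Hölder continuous representative. $\|Du\|_p:=\left(\int_{\mathbb{R}^n}|Du|^p\,dx\right)^{1/p}$. An admissible measure is a signed Borel measure $\rho$ on $\mathbb{R}^n$ with compact support, $\rho(\mathbb{R}^n)=0$, and $\int_{\mathbb{R}^n}y\,d\rho(y)\ne 0$. $\mathcal{S}(n)$ is the set of similarity transformations $S(y)=\lambda Oy+z$ of $\mathbb{R}^n$ with $\lambda>0$, $O\in\mathrm{O}(n)$, $z\in\mathbb{R}^n$. The push forward is $(S_\#\rho)(A)=\rho(S^{-1}(A))$ for Borel $A\subset\mathbb{R}^n$. For $u\in\mathcal{D}^{1,p}(\mathbb{R}^n)$, $$[u]_\rho:=\sup\left\{\frac{\left|\int u\,d\mu\right|}{\left|\int x\,d\mu(x)\right|^{1-n/p}}:\ \mu=S_\#\rho,\ S\in\mathcal{S}(n)\right\}.$$ $C_*$ is the smallest constant $C$ such that the generalized Morrey inequality $[u]_\rho\le C\|Du\|_p$ holds for all $u\in\mathcal{D}^{1,p}(\mathbb{R}^n)$. An extremal is a $u\in\mathcal{D}^{1,p}(\mathbb{R}^n)$ with $[u]_\rho=C_*\|Du\|_p$. *)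

theory Defs
  imports "HOL-Analysis.Analysis"
begin

(* Only the values on Borel sets matter.  Real values lose no generality for signed measures of
   total mass 0: one that takes an infinite value on some set has infinite total mass. *)
definition signed_borel_measure :: "((real^'n) set \<Rightarrow> real) \<Rightarrow> bool" where
  "signed_borel_measure \<rho> \<longleftrightarrow> \<rho> {} = 0 \<and>
     (\<forall>A :: nat \<Rightarrow> (real^'n) set. range A \<subseteq> sets borel \<and> disjoint_family A \<longrightarrow>
        (\<lambda>i. \<rho> (A i)) sums \<rho> (\<Union>i. A i))"

(* The Jordan decomposition; ennreal truncates negative values of \<rho> to 0, which does not affect
   the supremum because B = {} is admitted.  See emeasure_positive_part below. *)
definition positive_part :: "((real^'n) set \<Rightarrow> real) \<Rightarrow> (real^'n) measure" where
  "positive_part \<rho> = measure_of UNIV (sets borel)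
     (\<lambda>A. SUP B\<in>{B \<in> sets borel. B \<subseteq> A}. ennreal (\<rho> B))"

definition negative_part :: "((real^'n) set \<Rightarrow> real) \<Rightarrow> (real^'n) measure" where
  "negative_part \<rho> = positive_part (\<lambda>A. - \<rho> A)"

definition signed_integral ::
    "((real^'n) set \<Rightarrow> real) \<Rightarrow> (real^'n \<Rightarrow> 'b::{banach, second_countable_topology}) \<Rightarrow> 'b" where
  "signed_integral \<rho> f = (LINT x|positive_part \<rho>. f x) - (LINT x|negative_part \<rho>. f x)"

(* An open set is null for the total variation iff all its Borel subsets have measure 0. *)
definition signed_support :: "((real^'n) set \<Rightarrow> real) \<Rightarrow> (real^'n) set" where
  "signed_support \<rho> = {x. \<forall>U. open U \<and> x \<in> U \<longrightarrow> (\<exists>B\<in>sets borel. B \<subseteq> U \<and> \<rho> B \<noteq> 0)}"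

definition admissible :: "((real^'n) set \<Rightarrow> real) \<Rightarrow> bool" where
  "admissible \<rho> \<longleftrightarrow> signed_borel_measure \<rho> \<and> compact (signed_support \<rho>) \<and>
     \<rho> UNIV = 0 \<and> signed_integral \<rho> (\<lambda>y. y) \<noteq> 0"

definition similarities :: "(real^'n \<Rightarrow> real^'n) set" where
  "similarities = {S. \<exists>r>0. \<exists>R z. orthogonal_transformation R \<and> S = (\<lambda>y. r *\<^sub>R R y + z)}"

definition push_forward ::
    "(real^'n \<Rightarrow> real^'n) \<Rightarrow> ((real^'n) set \<Rightarrow> real) \<Rightarrow> (real^'n) set \<Rightarrow> real" where
  "push_forward S \<rho> = (\<lambda>A. \<rho> (S -` A))"

definition partial_deriv :: "'n \<Rightarrow> (real^'n \<Rightarrow> real) \<Rightarrow> real^'n \<Rightarrow> real" where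
  "partial_deriv i f x = frechet_derivative f (at x) (axis i 1)"

primrec C_k :: "nat \<Rightarrow> (real^'n \<Rightarrow> real) \<Rightarrow> bool" where
  "C_k 0 f \<longleftrightarrow> continuous_on UNIV f"
| "C_k (Suc k) f \<longleftrightarrow> (\<forall>x. f differentiable (at x)) \<and> (\<forall>i. C_k k (partial_deriv i f))"

definition test_functions :: "(real^'n \<Rightarrow> real) set" where
  "test_functions = {\<phi>. (\<forall>k. C_k k \<phi>) \<and> compact (closure {x. \<phi> x \<noteq> 0})}"

definition locally_integrable :: "(real^'n \<Rightarrow> real) \<Rightarrow> bool" where
  "locally_integrable f \<longleftrightarrow> (\<forall>K. compact K \<longrightarrow> set_integrable lborel K f)"

definition has_weak_partial ::
    "(real^'n \<Rightarrow> real) \<Rightarrow> 'n \<Rightarrow> (real^'n \<Rightarrow> real) \<Rightarrow> bool" where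
  "has_weak_partial u i g \<longleftrightarrow> locally_integrable u \<and> locally_integrable g \<and>
     (\<forall>\<phi>\<in>test_functions.
        (LINT x|lborel. u x * partial_deriv i \<phi> x) = - (LINT x|lborel. g x * \<phi> x))"

definition in_Lp :: "real \<Rightarrow> (real^'n \<Rightarrow> real) \<Rightarrow> bool" where
  "in_Lp p g \<longleftrightarrow> g \<in> borel_measurable lborel \<and> integrable lborel (\<lambda>x. \<bar>g x\<bar> powr p)"

(* The weak partial derivatives are determined up to null sets; Du picks one version. *)
definition weak_grad :: "(real^'n \<Rightarrow> real) \<Rightarrow> real^'n \<Rightarrow> real^'n" where
  "weak_grad u x = (\<chi> i. (SOME g. has_weak_partial u i g) x)"

definition holder_continuous :: "real \<Rightarrow> (real^'n \<Rightarrow> real) \<Rightarrow> bool" where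
  "holder_continuous \<alpha> u \<longleftrightarrow> (\<exists>C. \<forall>x y. \<bar>u x - u y\<bar> \<le> C * dist x y powr \<alpha>)"

(* For p > n.  The elements are the Hoelder continuous representatives of the equivalence classes
   of locally integrable functions, so that point values and integrals against arbitrary signed
   Borel measures are meaningful. *)
definition D1p :: "real \<Rightarrow> (real^'n \<Rightarrow> real) set" where
  "D1p p = {u. locally_integrable u \<and> (\<forall>i. \<exists>g. has_weak_partial u i g \<and> in_Lp p g) \<and>
     holder_continuous (1 - real CARD('n) / p) u}"

definition grad_norm :: "real \<Rightarrow> (real^'n \<Rightarrow> real) \<Rightarrow> real" where
  "grad_norm p u = (LINT x|lborel. norm (weak_grad u x) powr p) powr (1 / p)"

definition morrey_ratio ::
    "real \<Rightarrow> ((real^'n) set \<Rightarrow> real) \<Rightarrow> (real^'n \<Rightarrow> real) \<Rightarrow> real" where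
  "morrey_ratio p \<mu> u =
     \<bar>signed_integral \<mu> u\<bar> / norm (signed_integral \<mu> (\<lambda>x. x)) powr (1 - real CARD('n) / p)"

definition morrey_seminorm ::
    "real \<Rightarrow> ((real^'n) set \<Rightarrow> real) \<Rightarrow> (real^'n \<Rightarrow> real) \<Rightarrow> ennreal" where
  "morrey_seminorm p \<rho> u = (SUP S\<in>similarities. ennreal (morrey_ratio p (push_forward S \<rho>) u))"

(* The minimum is taken in [0, \<infinity>], where it always exists. *)
definition morrey_constant :: "real \<Rightarrow> ((real^'n) set \<Rightarrow> real) \<Rightarrow> ennreal" where
  "morrey_constant p \<rho> =
     (LEAST C. \<forall>u\<in>D1p p. morrey_seminorm p \<rho> u \<le> C * ennreal (grad_norm p u))"

definition extremal :: "real \<Rightarrow> ((real^'n) set \<Rightarrow> real) \<Rightarrow> (real^'n \<Rightarrow> real) \<Rightarrow> bool" where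
  "extremal p \<rho> u \<longleftrightarrow>
     u \<in> D1p p \<and> morrey_seminorm p \<rho> u = morrey_constant p \<rho> * ennreal (grad_norm p u)"

(* The weak form of the equation - \<Delta>\<^sub>p u = c \<mu> in the whole space, tested with D1p p.  For p < 2
   the weight is 0 where the gradient vanishes (0 powr (p - 2) = 0), as the vector field
   |Du|^(p-2) Du requires. *)
definition p_laplace_eq ::
    "real \<Rightarrow> (real^'n \<Rightarrow> real) \<Rightarrow> real \<Rightarrow> ((real^'n) set \<Rightarrow> real) \<Rightarrow> bool" where
  "p_laplace_eq p u c \<mu> \<longleftrightarrow> (\<forall>v\<in>D1p p.
     (LINT x|lborel. (norm (weak_grad u x) powr (p - 2) *\<^sub>R weak_grad u x) \<bullet> weak_grad v x)
       = c * signed_integral \<mu> v)"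

lemma signed_borel_measure_Un:
  assumes "signed_borel_measure \<rho>" "A \<in> sets borel" "B \<in> sets borel" "A \<inter> B = {}"
  shows "\<rho> (A \<union> B) = \<rho> A + \<rho> B"
proof -
  have "range (binaryset A B) \<subseteq> sets borel"
    using assms by (auto simp: range_binaryset_eq)
  moreover have "disjoint_family (binaryset A B)"
    using assms(4) by (auto simp: disjoint_family_on_def binaryset_def)
  ultimately have "(\<lambda>i. \<rho> (binaryset A B i)) sums \<rho> (\<Union>i. binaryset A B i)"
    using assms(1) unfolding signed_borel_measure_def by blast
  moreover have "(\<lambda>i. \<rho> (binaryset A B i)) sums (\<rho> A + \<rho> B)"
    using assms(1) by (intro binaryset_sums) (simp add: signed_borel_measure_def)
  ultimately show ?thesis
    by (metis UN_binaryset_eq sums_unique2)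
qed

lemma emeasure_positive_part:
  fixes \<rho> :: "(real^'n) set \<Rightarrow> real"
  assumes \<rho>: "signed_borel_measure \<rho>" and A: "A \<in> sets borel"
  shows "emeasure (positive_part \<rho>) A = (SUP B\<in>{B \<in> sets borel. B \<subseteq> A}. ennreal (\<rho> B))"
proof -
  define m where "m = (\<lambda>A. SUP B\<in>{B \<in> sets borel. B \<subseteq> A}. ennreal (\<rho> B))"
  have m_eq: "m A = (SUP B\<in>{B \<in> sets borel. B \<subseteq> A}. ennreal (\<rho> B))" for A
    by (simp add: m_def)
  have \<rho>0: "\<rho> {} = 0" using \<rho> by (simp add: signed_borel_measure_def)
  have pos: "positive (sets borel) m"
  proof -
    have "{B \<in> sets borel. B \<subseteq> {}} = {{} :: (real^'n) set}" by auto
    then show ?thesis using \<rho>0 by (simp add: positive_def m_eq)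
  qed
  have m_upper: "ennreal (\<rho> B) \<le> m A" if "B \<in> sets borel" "B \<subseteq> A" for A B
    unfolding m_def using that by (intro SUP_upper) auto
  have m_mono: "m A \<le> m B" if "A \<subseteq> B" for A B
    unfolding m_def using that by (intro SUP_subset_mono) auto
  have super: "m A + m B \<le> m (A \<union> B)" if "A \<in> sets borel" "B \<in> sets borel" "A \<inter> B = {}" for A B
  proof -
    have *: "ennreal (\<rho> P) + ennreal (\<rho> Q) \<le> m (A \<union> B)"
      if "P \<in> sets borel" "P \<subseteq> A" "Q \<in> sets borel" "Q \<subseteq> B" for P Q
    proof -
      have "\<rho> (P \<union> Q) = \<rho> P + \<rho> Q"
        using that \<open>A \<inter> B = {}\<close> by (intro signed_borel_measure_Un[OF \<rho>]) auto
      moreover have "ennreal (\<rho> (P \<union> Q)) \<le> m (A \<union> B)" "ennreal (\<rho> P) \<le> m (A \<union> B)"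
        "ennreal (\<rho> Q) \<le> m (A \<union> B)"
        using that by (auto intro!: m_upper)
      ultimately show ?thesis
        by (cases "\<rho> P \<ge> 0"; cases "\<rho> Q \<ge> 0") (auto simp: ennreal_neg)
    qed
    show ?thesis
      unfolding m_eq[of A] m_eq[of B]
      apply (subst ennreal_SUP_add_left[symmetric])
       apply blast
      apply (rule SUP_least)
      apply (subst ennreal_SUP_add_right)
       apply blast
      apply (rule SUP_least)
      using * by auto
  qed
  have "countably_additive (sets borel) m"
  proof (rule countably_additiveI)
    fix F :: "nat \<Rightarrow> (real^'n) set"
    assume F: "range F \<subseteq> sets borel" and dj: "disjoint_family F"
    have "(\<Sum>i. m (F i)) \<le> m (\<Union>i. F i)"
    proof (rule suminf_le_const)
      fix n
      have "(\<Sum>i<n. m (F i)) \<le> m (\<Union>i<n. F i)"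
      proof (induction n)
        case 0
        show ?case by simp
      next
        case (Suc n)
        have "(\<Union>i<n. F i) \<inter> F n = {}"
        proof -
          have "F i \<inter> F n = {}" if "i < n" for i
            using that by (intro disjoint_family_onD[OF dj]) auto
          then show ?thesis by blast
        qed
        moreover have "(\<Union>i<Suc n. F i) = (\<Union>i<n. F i) \<union> F n"
          by (simp add: lessThan_Suc Un_commute)
        moreover have "F n \<in> sets borel" "(\<Union>i<n. F i) \<in> sets borel"
          using F by (blast, intro sets.finite_UN) (use F in blast)+
        ultimately have "m (\<Union>i<n. F i) + m (F n) \<le> m (\<Union>i<Suc n. F i)"
          using super[of "\<Union>i<n. F i" "F n"] by metis
        from order_trans[OF add_right_mono[OF Suc] this] show ?case
          by simp
      qed
      also have "\<dots> \<le> m (\<Union>i. F i)"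
        by (intro m_mono) auto
      finally show "(\<Sum>i<n. m (F i)) \<le> m (\<Union>i. F i)" .
    qed auto
    moreover have "m (\<Union>i. F i) \<le> (\<Sum>i. m (F i))"
      unfolding m_eq[of "\<Union>i. F i"]
    proof (rule SUP_least)
      fix B assume "B \<in> {B \<in> sets borel. B \<subseteq> (\<Union>i. F i)}"
      then have B: "B \<in> sets borel" "B = (\<Union>i. B \<inter> F i)" by auto
      have BF: "B \<inter> F i \<in> sets borel" for i using B F by auto
      have "(\<lambda>i. \<rho> (B \<inter> F i)) sums \<rho> (\<Union>i. B \<inter> F i)"
      proof -
        have "range (\<lambda>i. B \<inter> F i) \<subseteq> sets borel" using BF by blast
        moreover have "disjoint_family (\<lambda>i. B \<inter> F i)"
          using dj by (rule disjoint_family_on_bisimulation) blast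
        ultimately show ?thesis
          using \<rho> unfolding signed_borel_measure_def by blast
      qed
      then have "(\<lambda>n. \<Sum>i<n. \<rho> (B \<inter> F i)) \<longlonglongrightarrow> \<rho> B"
        using B(2) by (simp add: sums_def)
      then have lim: "(\<lambda>n. ennreal (\<Sum>i<n. \<rho> (B \<inter> F i))) \<longlonglongrightarrow> ennreal (\<rho> B)"
        by (rule tendsto_ennrealI)
      show "ennreal (\<rho> B) \<le> (\<Sum>i. m (F i))"
      proof (rule LIMSEQ_le_const2[OF lim], intro exI allI impI)
        fix n
        have "ennreal (\<Sum>i<n. \<rho> (B \<inter> F i)) \<le> ennreal (\<Sum>i<n. max 0 (\<rho> (B \<inter> F i)))"
          by (intro ennreal_leI sum_mono) auto
        also have "\<dots> = (\<Sum>i<n. ennreal (max 0 (\<rho> (B \<inter> F i))))"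
          by (subst sum_ennreal) auto
        also have "\<dots> \<le> (\<Sum>i<n. m (F i))"
          using BF by (intro sum_mono) (auto intro!: m_upper simp: ennreal_max_0)
        also have "\<dots> \<le> (\<Sum>i. m (F i))"
          by (intro sum_le_suminf) auto
        finally show "ennreal (\<Sum>i<n. \<rho> (B \<inter> F i)) \<le> (\<Sum>i. m (F i))" .
      qed
    qed
    ultimately show "(\<Sum>i. m (F i)) = m (\<Union>i. F i)" by (rule antisym)
  qed
  moreover have "sigma_algebra UNIV (sets (borel :: (real^'n) measure))"
    by (metis sets.sigma_algebra_axioms space_borel)
  ultimately show ?thesis
    using pos A emeasure_measure_of_sigma[of UNIV "sets borel" m A]
    by (simp add: positive_part_def m_def)
qed

end

theory Submission
  imports Defs
begin

text \<open>
  Write L for integration against \<open>\<mu>\<close>, and let V(a) = |a|^(p-2) a. Young's inequality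
  p V(a) . b \<le> (p-1) |a|^p + |b|^p shows that a solution u of the equation minimises the energy
  among all v with L v = L u. Conversely, applied to Du + t Dw and Du it shows for a minimiser u and
  L w = 0 that the integral of V(Du + t Dw) . Dw is nonnegative for t > 0, so, letting t tend to 0,
  that of V(Du) . Dw vanishes; hence the latter, as a functional of w, is a multiple of L.

  By homogeneity u is a minimiser iff |L w| ||Du|| \<le> |L u| ||Dw|| for all w. The ratios
  |L w| / |\<integral> x d\<mu>|^(1-n/p) and the gradient norm scale alike under similarities, so for nonconstant u
  this says that the Morrey constant, a supremum over all similarities, is attained at u and \<open>\<mu>\<close>.
  The finiteness of that constant is not needed: if it is infinite, then an extremal whose ratio is
  attained has zero gradient. It is positive because L does not vanish on all test functions, as
  otherwise \<open>\<mu>\<close> would be 0.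
\<close>

section \<open>Signed measures and similarities\<close>

text \<open>\<open>weak_grad\<close> is a choice by \<open>SOME\<close> among versions of the weak
  derivatives, so no identity for it can be computed directly: each is obtained by exhibiting some
  family of weak partial derivatives and appealing to uniqueness almost everywhere. That uniqueness,
  and the fact that a nonzero \<open>\<mu>\<close> is seen by some test function, rest on one
  principle: smooth bumps approximate indicators of boxes, so test functions determine measures.

  Total mass 0 makes the integral blind to constants and hence to the translation part of a
  similarity. Constants are also exactly the functions of gradient norm 0. This matters where the
  gradient norm vanishes: no quotient can be formed there, and in [0, infinity] the product of
  infinity and 0 is 0, so the Morrey inequality demands seminorm 0. It holds because a continuous
  function with zero weak gradient is constant.

  The exponent 1 - n/p comes from a dilation by r: the p-th power of the gradient gains r^p, the
  volume gains r^(-n), and a p-th root is taken. Hoelder continuity is part of \<open>D1p\<close>,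
  so it has to be checked for every function that is constructed: sums, multiples, composites with
  similarities, and test functions.\<close>

lemma signed_borel_measure_diff:
  assumes "signed_borel_measure \<rho>" "A \<in> sets borel" "B \<in> sets borel" "B \<subseteq> A"
  shows "\<rho> (A - B) = \<rho> A - \<rho> B"
proof -
  have "\<rho> (B \<union> (A - B)) = \<rho> B + \<rho> (A - B)"
    using assms by (intro signed_borel_measure_Un) auto
  moreover have "B \<union> (A - B) = A" using assms by auto
  ultimately show ?thesis by simp
qed

lemma signed_borel_measure_uminus:
  "signed_borel_measure \<rho> \<Longrightarrow> signed_borel_measure (\<lambda>A. - \<rho> A)"
  unfolding signed_borel_measure_def by (auto intro: sums_minus)

lemma sets_positive_part [measurable_cong, simp]: "sets (positive_part \<rho>) = sets borel"
  and space_positive_part [simp]: "space (positive_part \<rho>) = UNIV"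
  using sets.sets_measure_of_eq[of borel] by (simp_all add: positive_part_def space_measure_of_conv)

lemma sets_negative_part [measurable_cong, simp]: "sets (negative_part \<rho>) = sets borel"
  and space_negative_part [simp]: "space (negative_part \<rho>) = UNIV"
  by (simp_all add: negative_part_def)

text \<open>Were the supremum infinite, one could split off disjoint pieces of measure at least 1 in
  absolute value forever, and the series of their measures would diverge.\<close>
lemma finite_measure_positive_part:
  fixes \<rho> :: "(real^'n) set \<Rightarrow> real"
  assumes \<rho>: "signed_borel_measure \<rho>"
  shows "finite_measure (positive_part \<rho>)"
proof (rule ccontr)
  define m where "m = emeasure (positive_part \<rho>)"
  define I where "I A \<longleftrightarrow> A \<in> sets borel \<and> m A = \<infinity>" for A
  assume "\<not> ?thesis"
  then have top: "I UNIV"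
    using finite_measureI[of "positive_part \<rho>"] by (auto simp: m_def I_def)
  have step: "\<exists>A'. I A' \<and> A' \<subseteq> A \<and> \<bar>\<rho> (A - A')\<bar> \<ge> 1" if A: "I A" for A
  proof -
    have "m A = (SUP B\<in>{B \<in> sets borel. B \<subseteq> A}. ennreal (\<rho> B))"
      using A emeasure_positive_part[OF \<rho>] unfolding m_def I_def by blast
    \<comment> \<open>This threshold makes both halves of A usable: it gives |rho B| >= 1 and |rho
      (A - B)| = |rho A - rho B| >= 1. By additivity of \<open>m\<close> one half still has infinite
      measure; that half is kept and the other is split off.\<close>
    then have "ennreal (\<bar>\<rho> A\<bar> + 1) < (SUP B\<in>{B \<in> sets borel. B \<subseteq> A}. ennreal (\<rho> B))"
      using A ennreal_less_top[of "\<bar>\<rho> A\<bar> + 1"] unfolding I_def by (metis infinity_ennreal_def)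
    then obtain B where B: "B \<in> sets borel" "B \<subseteq> A" "ennreal (\<bar>\<rho> A\<bar> + 1) < ennreal (\<rho> B)"
      by (auto simp: less_SUP_iff)
    then have B1: "\<rho> B > \<bar>\<rho> A\<bar> + 1"
      by (meson ennreal_leI linorder_not_less)
    have d: "\<rho> (A - B) = \<rho> A - \<rho> B" using A B \<rho> by (intro signed_borel_measure_diff) (auto simp: I_def)
    have "m B + m (A - B) = m (B \<union> (A - B))"
      unfolding m_def using A B by (intro plus_emeasure) (auto simp: I_def)
    also have "B \<union> (A - B) = A" using B by auto
    finally have "m B = \<infinity> \<or> m (A - B) = \<infinity>"
      using A by (auto simp: I_def)
    then show ?thesis
    proof
      assume "m B = \<infinity>"
      then show ?thesis using B B1 d by (intro exI[of _ B]) (auto simp: I_def)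
    next
      assume "m (A - B) = \<infinity>"
      moreover have "A - (A - B) = B" using B by auto
      ultimately show ?thesis using A B B1 by (intro exI[of _ "A - B"]) (auto simp: I_def)
    qed
  qed
  obtain X where X0: "X 0 = UNIV"
    and X: "\<And>n. I (X n)" "\<And>n. X (Suc n) \<subseteq> X n \<and> \<bar>\<rho> (X n - X (Suc n))\<bar> \<ge> 1"
    using dependent_nat_choice[where P="\<lambda>n A. I A \<and> (n = 0 \<longrightarrow> A = UNIV)"
        and Q="\<lambda>n A A'. A' \<subseteq> A \<and> \<bar>\<rho> (A - A')\<bar> \<ge> 1"] step top
    by (metis nat.simps(3))
  define D where "D n = X n - X (Suc n)" for n
  have mono: "X n \<subseteq> X m" if "m \<le> n" for m n
    using that X(2) by (metis lift_Suc_antimono_le)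
  have "disjoint_family D"
    unfolding disjoint_family_on_def
  proof (intro ballI impI)
    fix i j :: nat assume "i \<noteq> j"
    then have "Suc i \<le> j \<or> Suc j \<le> i" by linarith
    then show "D i \<inter> D j = {}" using mono by (fastforce simp: D_def)
  qed
  moreover have "range D \<subseteq> sets borel"
    using X(1) by (auto simp: D_def I_def)
  ultimately have "(\<lambda>i. \<rho> (D i)) sums \<rho> (\<Union>i. D i)"
    using \<rho> unfolding signed_borel_measure_def by blast
  then have "(\<lambda>i. \<rho> (D i)) \<longlonglongrightarrow> 0"
    using sums_summable summable_LIMSEQ_zero by blast
  then have "eventually (\<lambda>i. \<bar>\<rho> (D i)\<bar> < 1) sequentially"
    by (intro order_tendstoD(2)[OF tendsto_rabs_zero]) auto
  then obtain i where "\<bar>\<rho> (D i)\<bar> < 1"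
    by (auto simp: eventually_sequentially)
  then show False
    using X(2)[of i] by (simp add: D_def)
qed

lemma finite_measure_negative_part:
  "signed_borel_measure \<rho> \<Longrightarrow> finite_measure (negative_part \<rho>)"
  unfolding negative_part_def
  by (intro finite_measure_positive_part signed_borel_measure_uminus)

lemma signed_support_uminus: "signed_support (\<lambda>A. - \<rho> A) = signed_support \<rho>"
  by (simp add: signed_support_def)

text \<open>The complement of the support is a union of open null sets, possibly uncountably many;
  the Lindelof property reduces it to a countable union, which is null.\<close>

lemma AE_positive_part_signed_support:
  fixes \<rho> :: "(real^'n) set \<Rightarrow> real"
  assumes \<rho>: "signed_borel_measure \<rho>"
  shows "AE x in positive_part \<rho>. x \<in> signed_support \<rho>"
proof -
  define \<U> where "\<U> = {U. open U \<and> (\<forall>B\<in>sets borel. B \<subseteq> U \<longrightarrow> \<rho> B = 0)}"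
  have U: "- signed_support \<rho> \<subseteq> \<Union>\<U>"
    by (auto simp: signed_support_def \<U>_def)
  have "\<And>U. U \<in> \<U> \<Longrightarrow> open U" by (auto simp: \<U>_def)
  then obtain \<V> where \<V>: "\<V> \<subseteq> \<U>" "countable \<V>" "\<Union>\<V> = \<Union>\<U>"
    using Lindelof by metis
  have "U \<in> null_sets (positive_part \<rho>)" if "U \<in> \<V>" for U
  proof -
    have "open U" "\<forall>B\<in>sets borel. B \<subseteq> U \<longrightarrow> \<rho> B = 0" using that \<V> by (auto simp: \<U>_def)
    then show ?thesis
      by (intro null_setsI) (auto simp: emeasure_positive_part[OF \<rho>] intro!: antisym SUP_least)
  qed
  then have "\<Union>\<V> \<in> null_sets (positive_part \<rho>)"
    using \<V>(2) null_sets_UN'[of \<V> "\<lambda>U. U"] by simp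
  then show ?thesis
    using U \<V>(3) by (intro AE_I'[of "\<Union>\<V>"]) auto
qed

text \<open>On the compact support a continuous function is bounded, which is a bound almost
  everywhere for a finite measure. Integrability guards against the default value 0 of the Bochner
  integral, which would destroy the linearity of \<open>signed_integral\<close>.\<close>

lemma integrable_positive_part:
  fixes f :: "real^'n \<Rightarrow> 'b::euclidean_space"
  assumes \<rho>: "signed_borel_measure \<rho>" and K: "compact (signed_support \<rho>)" and f: "continuous_on UNIV f"
  shows "integrable (positive_part \<rho>) f"
proof -
  interpret finite_measure "positive_part \<rho>" by (rule finite_measure_positive_part[OF \<rho>])
  have "bounded (f ` signed_support \<rho>)"
    using K f by (meson compact_continuous_image compact_imp_bounded continuous_on_subset subset_UNIV)
  then obtain B where "\<forall>x\<in>signed_support \<rho>. norm (f x) \<le> B"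
    by (auto simp: bounded_iff)
  moreover have "f \<in> borel_measurable borel" using f by (rule borel_measurable_continuous_onI)
  ultimately show ?thesis
    using AE_positive_part_signed_support[OF \<rho>]
    by (intro integrable_const_bound[of _ B]) auto
qed

lemma integrable_negative_part:
  fixes f :: "real^'n \<Rightarrow> 'b::euclidean_space"
  assumes "signed_borel_measure \<rho>" "compact (signed_support \<rho>)" "continuous_on UNIV f"
  shows "integrable (negative_part \<rho>) f"
  unfolding negative_part_def using assms
  by (intro integrable_positive_part signed_borel_measure_uminus) (auto simp: signed_support_uminus)

text \<open>Since the total mass is 0, passing to the complement changes the sign of
  \<open>\<rho>\<close>. Hence \<open>\<rho>\<close> and its negative take the same set of values,
  and the two suprema agree. This is why constants integrate to 0.\<close>

lemma measure_positive_part_UNIV: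
  fixes \<rho> :: "(real^'n) set \<Rightarrow> real"
  assumes \<rho>: "signed_borel_measure \<rho>" and 0: "\<rho> UNIV = 0"
  shows "emeasure (positive_part \<rho>) UNIV = emeasure (negative_part \<rho>) UNIV"
proof -
  have c: "\<rho> (- B) = - \<rho> B" if "B \<in> sets borel" for B
    using signed_borel_measure_diff[OF \<rho>, of UNIV B] that 0 by (simp add: Compl_eq_Diff_UNIV)
  have "(\<lambda>B. ennreal (\<rho> B)) ` sets borel = (\<lambda>B. ennreal (- \<rho> B)) ` sets borel"
  proof (intro set_eqI iffI; elim imageE; simp)
    fix B :: "(real^'n) set" assume "B \<in> sets borel"
    then show "ennreal (\<rho> B) \<in> (\<lambda>B. ennreal (- \<rho> B)) ` sets borel"
      "ennreal (- \<rho> B) \<in> (\<lambda>B. ennreal (\<rho> B)) ` sets borel"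
      by (auto intro!: image_eqI[of _ _ "- B"] simp: c borel_comp)
  qed
  then show ?thesis
    unfolding negative_part_def
    by (simp add: emeasure_positive_part[OF \<rho>] emeasure_positive_part[OF signed_borel_measure_uminus[OF \<rho>]])
qed

lemma signed_integral_const:
  fixes \<rho> :: "(real^'n) set \<Rightarrow> real"
  assumes "signed_borel_measure \<rho>" "\<rho> UNIV = 0"
  shows "signed_integral \<rho> (\<lambda>x. c) = 0"
  using measure_positive_part_UNIV[OF assms] by (simp add: signed_integral_def measure_def)

lemma signed_integral_linear:
  fixes f g :: "real^'n \<Rightarrow> 'b::euclidean_space"
  assumes "signed_borel_measure \<rho>" "compact (signed_support \<rho>)"
    "continuous_on UNIV f" "continuous_on UNIV g"
  shows signed_integral_add: "signed_integral \<rho> (\<lambda>x. f x + g x) = signed_integral \<rho> f + signed_integral \<rho> g"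
    and signed_integral_scaleR: "signed_integral \<rho> (\<lambda>x. c *\<^sub>R f x) = c *\<^sub>R signed_integral \<rho> f"
proof -
  note [simp] = integrable_positive_part[OF assms(1,2,3)] integrable_positive_part[OF assms(1,2,4)]
    integrable_negative_part[OF assms(1,2,3)] integrable_negative_part[OF assms(1,2,4)]
  show "signed_integral \<rho> (\<lambda>x. f x + g x) = signed_integral \<rho> f + signed_integral \<rho> g"
    "signed_integral \<rho> (\<lambda>x. c *\<^sub>R f x) = c *\<^sub>R signed_integral \<rho> f"
    by (simp_all add: signed_integral_def scaleR_diff_right)
qed

lemma signed_integral_bounded_linear:
  fixes f :: "real^'n \<Rightarrow> 'b::euclidean_space" and h :: "'b \<Rightarrow> 'c::euclidean_space"
  assumes "signed_borel_measure \<rho>" "compact (signed_support \<rho>)" "continuous_on UNIV f" "bounded_linear h"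
  shows "signed_integral \<rho> (\<lambda>x. h (f x)) = h (signed_integral \<rho> f)"
  by (simp add: signed_integral_def integral_bounded_linear[OF assms(4)]
      integrable_positive_part[OF assms(1-3)] integrable_negative_part[OF assms(1-3)]
      linear_diff[OF bounded_linear.linear[OF assms(4)]])

section \<open>Similarity transformations and push forwards along them\<close>

lemma similarityE:
  assumes "S \<in> similarities"
  obtains r R z where "r > 0" "orthogonal_transformation R" "S = (\<lambda>y. r *\<^sub>R R y + z)"
  using assms unfolding similarities_def by (elim CollectE exE conjE) (rule that)

lemma similarity_inverse:
  fixes S :: "real^'n \<Rightarrow> real^'n"
  assumes S: "S \<in> similarities"
  obtains S' where "S' \<in> similarities" "\<And>x. S (S' x) = x" "\<And>x. S' (S x) = x"
proof -
  obtain r R z where r: "r > 0" and R: "orthogonal_transformation R" and S: "S = (\<lambda>y. r *\<^sub>R R y + z)"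
    by (rule similarityE[OF S])
  define R' where "R' = inv R"
  have R': "orthogonal_transformation R'"
    unfolding R'_def using R by (rule orthogonal_transformation_inv)
  have RR: "R (R' x) = x" "R' (R x) = x" for x
    unfolding R'_def using orthogonal_transformation_bij[OF R]
    by (simp_all add: bij_is_surj surj_f_inv_f bij_is_inj)
  have lin: "linear R" "linear R'"
    using R R' by (simp_all add: orthogonal_transformation_linear)
  define S' where "S' = (\<lambda>y. (1/r) *\<^sub>R R' y + (1/r) *\<^sub>R R' (- z))"
  show thesis
  proof
    show "S' \<in> similarities" using r R' unfolding S'_def similarities_def
      by (auto intro!: exI[of _ "1/r"] exI[of _ R'] exI[of _ "(1/r) *\<^sub>R R' (- z)"])
    show "S (S' x) = x" for x
      using r by (simp add: S S'_def linear_add[OF lin(1)] linear_diff[OF lin(1)] linear_scale[OF lin(1)] RR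
          scaleR_diff_right)
    show "S' (S x) = x" for x
      using r by (simp add: S S'_def scaleR_add_right linear_add[OF lin(2)] linear_scale[OF lin(2)] linear_neg[OF lin(2)] RR)
  qed
qed

lemma similarity_comp:
  fixes S T :: "real^'n \<Rightarrow> real^'n"
  assumes S: "S \<in> similarities" and T: "T \<in> similarities"
  shows "(\<lambda>x. S (T x)) \<in> similarities"
proof -
  obtain r R z where r: "r > 0" and R: "orthogonal_transformation R" and S: "S = (\<lambda>y. r *\<^sub>R R y + z)"
    by (rule similarityE[OF S])
  obtain s Q w where s: "s > 0" and Q: "orthogonal_transformation Q" and T: "T = (\<lambda>y. s *\<^sub>R Q y + w)"
    by (rule similarityE[OF T])
  have lin: "linear R" using R by (simp add: orthogonal_transformation_linear)
  have "(\<lambda>x. S (T x)) = (\<lambda>y. (r * s) *\<^sub>R (R \<circ> Q) y + (r *\<^sub>R R w + z))"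
    by (simp add: fun_eq_iff S T linear_add[OF lin] linear_scale[OF lin] scaleR_add_right)
  then show ?thesis
    unfolding similarities_def using r s orthogonal_transformation_compose[OF R Q]
    by (auto intro!: exI[of _ "r * s"] exI[of _ "R \<circ> Q"] exI[of _ "r *\<^sub>R R w + z"])
qed

lemma continuous_on_similarity:
  assumes "S \<in> similarities"
  shows "continuous_on A S"
proof -
  obtain r R z where "orthogonal_transformation R" and S: "S = (\<lambda>y. r *\<^sub>R R y + z)"
    by (rule similarityE[OF assms])
  then have "continuous_on A R"
    by (simp add: linear_continuous_on linear_linear orthogonal_transformation_linear)
  then show ?thesis unfolding S by (intro continuous_intros)
qed

lemma borel_measurable_similarity:
  "S \<in> similarities \<Longrightarrow> S \<in> borel_measurable borel"
  by (intro borel_measurable_continuous_onI continuous_on_similarity)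

lemma signed_borel_measure_push_forward:
  fixes S :: "real^'n \<Rightarrow> real^'n"
  assumes \<rho>: "signed_borel_measure \<rho>" and S[measurable]: "S \<in> borel_measurable borel"
  shows "signed_borel_measure (push_forward S \<rho>)"
  unfolding signed_borel_measure_def
proof (intro conjI allI impI)
  show "push_forward S \<rho> {} = 0" using \<rho> by (simp add: push_forward_def signed_borel_measure_def)
  fix A :: "nat \<Rightarrow> (real^'n) set"
  assume A: "range A \<subseteq> sets borel \<and> disjoint_family A"
  have "range (\<lambda>i. S -` A i) \<subseteq> sets borel"
    using A measurable_sets[OF S] by (fastforce simp: image_subset_iff)
  moreover have "disjoint_family (\<lambda>i. S -` A i)"
    using A by (fastforce simp: disjoint_family_on_def)
  ultimately have "(\<lambda>i. \<rho> (S -` A i)) sums \<rho> (\<Union>i. S -` A i)"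
    using \<rho> unfolding signed_borel_measure_def by blast
  then show "(\<lambda>i. push_forward S \<rho> (A i)) sums push_forward S \<rho> (\<Union>i. A i)"
    by (simp add: push_forward_def vimage_UN)
qed

text \<open>A similarity has a Borel inverse, so the Borel subsets of the preimage of A are exactly
  the preimages of Borel subsets of A, and both suprema run over the same values. A map that is not
  injective could cancel positive against negative mass.\<close>

lemma positive_part_push_forward:
  fixes S :: "real^'n \<Rightarrow> real^'n"
  assumes \<rho>: "signed_borel_measure \<rho>" and "S \<in> similarities"
  shows "positive_part (push_forward S \<rho>) = distr (positive_part \<rho>) borel S"
proof (rule measure_eqI)
  obtain S' where S': "S' \<in> similarities" "\<And>x. S (S' x) = x" "\<And>x. S' (S x) = x"
    using similarity_inverse assms(2) by metis
  have [measurable]: "S \<in> borel_measurable borel" "S' \<in> borel_measurable borel"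
    using assms(2) S'(1) by (auto intro: borel_measurable_similarity)
  have vimage_borel: "S -` B \<in> sets borel" "S' -` B \<in> sets borel" if "B \<in> sets borel" for B
    using that measurable_sets[of S borel borel B] measurable_sets[of S' borel borel B] by auto
  fix A assume "A \<in> sets (positive_part (push_forward S \<rho>))"
  then have A[measurable]: "A \<in> sets borel" by simp
  have "push_forward S \<rho> ` {B \<in> sets borel. B \<subseteq> A} = \<rho> ` {B \<in> sets borel. B \<subseteq> S -` A}"
  proof (intro set_eqI iffI; elim imageE)
    fix y B assume "y = push_forward S \<rho> B" "B \<in> {B \<in> sets borel. B \<subseteq> A}"
    then show "y \<in> \<rho> ` {B \<in> sets borel. B \<subseteq> S -` A}"
      using vimage_borel by (intro image_eqI[of _ _ "S -` B"]) (auto simp: push_forward_def)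
  next
    fix y B assume y: "y = \<rho> B" "B \<in> {B \<in> sets borel. B \<subseteq> S -` A}"
    then have "S -` (S' -` B) = B" "S' -` B \<subseteq> A" using S' by force+
    then show "y \<in> push_forward S \<rho> ` {B \<in> sets borel. B \<subseteq> A}"
      using y vimage_borel by (intro image_eqI[of _ _ "S' -` B"]) (auto simp: push_forward_def)
  qed
  then have "(\<lambda>B. ennreal (push_forward S \<rho> B)) ` {B \<in> sets borel. B \<subseteq> A}
      = (\<lambda>B. ennreal (\<rho> B)) ` {B \<in> sets borel. B \<subseteq> S -` A}"
    by (metis image_image)
  moreover have "signed_borel_measure (push_forward S \<rho>)"
    using \<rho> by (intro signed_borel_measure_push_forward) auto
  moreover have "S \<in> measurable (positive_part \<rho>) borel"
    by measurable
  ultimately show "emeasure (positive_part (push_forward S \<rho>)) A = emeasure (distr (positive_part \<rho>) borel S) A"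
    using vimage_borel(1)[OF A]
    by (simp add: emeasure_positive_part \<rho> emeasure_distr)
qed simp

lemma negative_part_push_forward:
  fixes S :: "real^'n \<Rightarrow> real^'n"
  assumes \<rho>: "signed_borel_measure \<rho>" and S: "S \<in> similarities"
  shows "negative_part (push_forward S \<rho>) = distr (negative_part \<rho>) borel S"
  using positive_part_push_forward[OF signed_borel_measure_uminus[OF \<rho>] S]
  by (simp add: negative_part_def push_forward_def)

lemma signed_integral_push_forward:
  fixes f :: "real^'n \<Rightarrow> 'b::{banach, second_countable_topology}"
  assumes \<rho>: "signed_borel_measure \<rho>" and S: "S \<in> similarities" and f: "continuous_on UNIV f"
  shows "signed_integral (push_forward S \<rho>) f = signed_integral \<rho> (\<lambda>x. f (S x))"
proof -
  have [measurable]: "f \<in> borel_measurable borel" "S \<in> borel_measurable borel"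
    using f S by (auto intro: borel_measurable_continuous_onI borel_measurable_similarity)
  have "S \<in> measurable (positive_part \<rho>) borel" "S \<in> measurable (negative_part \<rho>) borel"
    by measurable
  then show ?thesis
    by (simp add: signed_integral_def positive_part_push_forward[OF \<rho> S]
        negative_part_push_forward[OF \<rho> S] integral_distr)
qed

text \<open>One inclusion is enough to carry compactness over: the support is closed, and the image
  of a compact support is compact.\<close>

lemma signed_support_push_forward:
  fixes S :: "real^'n \<Rightarrow> real^'n"
  assumes S: "S \<in> similarities"
  shows "signed_support (push_forward S \<rho>) \<subseteq> S ` signed_support \<rho>"
proof
  obtain S' where S': "S' \<in> similarities" "\<And>x. S (S' x) = x" "\<And>x. S' (S x) = x"
    using similarity_inverse S by metis
  fix y assume y: "y \<in> signed_support (push_forward S \<rho>)"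
  have "S' y \<in> signed_support \<rho>"
    unfolding signed_support_def
  proof (intro CollectI allI impI)
    fix U assume U: "open U \<and> S' y \<in> U"
    then have "open (S' -` U)"
      using continuous_on_similarity[OF S'(1), of UNIV] by (simp add: open_vimage)
    then obtain B where B: "B \<in> sets borel" "B \<subseteq> S' -` U" "push_forward S \<rho> B \<noteq> 0"
      using y U unfolding signed_support_def by blast
    have "S -` B \<in> sets borel"
      using measurable_sets[OF borel_measurable_similarity[OF S] B(1)] by simp
    moreover have "S -` B \<subseteq> U" using B(2) S'(3) by force
    ultimately show "\<exists>B\<in>sets borel. B \<subseteq> U \<and> \<rho> B \<noteq> 0"
      using B(3) by (auto simp: push_forward_def)
  qed
  then show "y \<in> S ` signed_support \<rho>" using S'(2)[of y] by (metis image_eqI)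
qed

lemma closed_signed_support: "closed (signed_support (\<rho> :: (real^'n) set \<Rightarrow> real))"
  unfolding closed_def signed_support_def
  by (subst open_subopen) blast

text \<open>The translation z drops out because the total mass is 0, and R preserves the norm. The
  remaining factor r is what the denominator of the Morrey ratio contributes under a change of
  similarity.\<close>

lemma signed_integral_push_forward_id:
  fixes T :: "real^'n \<Rightarrow> real^'n"
  assumes "signed_borel_measure \<rho>" "compact (signed_support \<rho>)" "\<rho> UNIV = 0"
    and r: "r > 0" and R: "orthogonal_transformation R" and T: "T = (\<lambda>y. r *\<^sub>R R y + z)"
  shows "norm (signed_integral (push_forward T \<rho>) (\<lambda>x. x)) = r * norm (signed_integral \<rho> (\<lambda>x. x))"
proof -
  have lin: "bounded_linear R" using R by (simp add: linear_linear orthogonal_transformation_linear)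
  have sim: "T \<in> similarities" using r R T by (auto simp: similarities_def)
  have cont: "continuous_on UNIV R" using lin by (rule linear_continuous_on)
  have "signed_integral (push_forward T \<rho>) (\<lambda>x. x) = signed_integral \<rho> (\<lambda>y. r *\<^sub>R R y + z)"
    using assms sim by (subst signed_integral_push_forward) auto
  also have "\<dots> = signed_integral \<rho> (\<lambda>y. r *\<^sub>R R y) + signed_integral \<rho> (\<lambda>y. z)"
    using assms cont by (intro signed_integral_add continuous_intros) auto
  also have "\<dots> = r *\<^sub>R R (signed_integral \<rho> (\<lambda>y. y))"
    using assms cont signed_integral_bounded_linear[OF assms(1,2) continuous_on_id lin]
    by (simp add: signed_integral_const signed_integral_scaleR[OF _ _ _ cont])
  finally show ?thesis
    using r R by (simp add: orthogonal_transformation_norm)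
qed

lemma admissible_push_forward:
  fixes S :: "real^'n \<Rightarrow> real^'n"
  assumes \<rho>: "admissible \<rho>" and S: "S \<in> similarities"
  shows "admissible (push_forward S \<rho>)"
proof -
  have "compact (S ` signed_support \<rho>)"
    using \<rho> S by (intro compact_continuous_image continuous_on_similarity) (auto simp: admissible_def)
  then have "compact (signed_support (push_forward S \<rho>))"
    using signed_support_push_forward[OF S] closed_signed_support
    by (metis bounded_subset compact_eq_bounded_closed)
  moreover have "signed_integral (push_forward S \<rho>) (\<lambda>y. y) \<noteq> 0"
  proof -
    obtain r R z where "r > 0" "orthogonal_transformation R" "S = (\<lambda>y. r *\<^sub>R R y + z)"
      by (rule similarityE[OF S])
    then show ?thesis
      using \<rho> signed_integral_push_forward_id[of \<rho> r R S z] by (auto simp: admissible_def)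
  qed
  ultimately show ?thesis
    using \<rho> signed_borel_measure_push_forward[OF _ borel_measurable_similarity[OF S]]
    by (simp add: admissible_def) (simp add: push_forward_def)
qed

section \<open>Test functions and uniqueness of weak derivatives\<close>

lemma partial_deriv_eqI: "(f has_derivative f') (at x) \<Longrightarrow> partial_deriv i f x = f' (axis i 1)"
  by (simp add: partial_deriv_def frechet_derivative_at[symmetric])

lemma has_derivative_partial_deriv:
  fixes f :: "real^'n \<Rightarrow> real"
  assumes "f differentiable (at x)"
  shows "(f has_derivative (\<lambda>v. \<Sum>j\<in>UNIV. v $ j * partial_deriv j f x)) (at x)"
proof -
  define D where "D = frechet_derivative f (at x)"
  have D: "(f has_derivative D) (at x)"
    using assms by (simp add: D_def frechet_derivative_works)
  then have lin: "linear D" by (rule has_derivative_linear)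
  have "D v = (\<Sum>j\<in>UNIV. v $ j * partial_deriv j f x)" for v
  proof -
    have "D v = D (\<Sum>j\<in>UNIV. v $ j *\<^sub>R axis j 1)"
      using basis_expansion[of v] by (simp add: scalar_mult_eq_scaleR)
    then show ?thesis
      by (simp add: linear_sum[OF lin] linear_scale[OF lin] partial_deriv_eqI[OF D])
  qed
  then show ?thesis using D by presburger
qed

lemma C_k_Suc_imp_C_k: "C_k (Suc k) f \<Longrightarrow> C_k k f"
proof (induction k arbitrary: f)
  case 0
  then show ?case
    by (auto simp: continuous_on_eq_continuous_at intro: differentiable_imp_continuous_within)
next
  case (Suc k)
  then show ?case by (metis C_k.simps(2))
qed

lemma C_k_const: "C_k k (\<lambda>x. c)"
proof (induction k arbitrary: c)
  case (Suc k)
  have "partial_deriv i (\<lambda>x. c) = (\<lambda>x. 0)" for i :: 'a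
    by (rule ext) (rule partial_deriv_eqI[OF has_derivative_const])
  then show ?case using Suc by simp
qed simp

lemma C_k_add:
  assumes "C_k k f" "C_k k g"
  shows "C_k k (\<lambda>x. f x + g x)"
  using assms
proof (induction k arbitrary: f g)
  case 0
  then show ?case by (auto intro: continuous_intros)
next
  case (Suc k)
  have d: "(f has_derivative frechet_derivative f (at x)) (at x)"
      "(g has_derivative frechet_derivative g (at x)) (at x)" for x
    using Suc.prems by (simp_all add: frechet_derivative_works)
  then have "partial_deriv i (\<lambda>x. f x + g x) = (\<lambda>x. partial_deriv i f x + partial_deriv i g x)" for i
    using partial_deriv_eqI[OF has_derivative_add[OF d]] by (auto simp: partial_deriv_def)
  then show ?case using Suc by (auto intro: differentiable_add)
qed

lemma C_k_mult:
  assumes "C_k k f" "C_k k g"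
  shows "C_k k (\<lambda>x. f x * g x)"
  using assms
proof (induction k arbitrary: f g)
  case 0
  then show ?case by (auto intro: continuous_intros)
next
  case (Suc k)
  have d: "(f has_derivative frechet_derivative f (at x)) (at x)"
      "(g has_derivative frechet_derivative g (at x)) (at x)" for x
    using Suc.prems by (simp_all add: frechet_derivative_works)
  then have "partial_deriv i (\<lambda>x. f x * g x) = (\<lambda>x. f x * partial_deriv i g x + partial_deriv i f x * g x)" for i
    using partial_deriv_eqI[OF has_derivative_mult[OF d]] by (auto simp: partial_deriv_def)
  \<comment> \<open>The product rule leaves undifferentiated factors, so their order must be lowered
    before the induction hypothesis applies to the two products.\<close>
  moreover have "C_k k f" "C_k k g"
    using Suc.prems by (auto intro: C_k_Suc_imp_C_k)
  ultimately show ?case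
    using Suc by (auto intro!: differentiable_mult C_k_add)
qed

lemma C_k_sum: "(\<And>i. i \<in> A \<Longrightarrow> C_k k (f i)) \<Longrightarrow> C_k k (\<lambda>x. \<Sum>i\<in>A. f i x)"
  by (induction A rule: infinite_finite_induct) (auto simp: C_k_const C_k_add)

lemma C_k_prod: "(\<And>i. i \<in> A \<Longrightarrow> C_k k (f i)) \<Longrightarrow> C_k k (\<lambda>x. \<Prod>i\<in>A. f i x)"
  by (induction A rule: infinite_finite_induct) (auto simp: C_k_const C_k_mult)

lemma has_derivative_affine_compose:
  fixes f :: "real^'n \<Rightarrow> real" and L :: "real^'m \<Rightarrow> real^'n"
  assumes "f differentiable (at (L x + z))" "linear L"
  shows "((\<lambda>x. f (L x + z)) has_derivative
    (\<lambda>v. \<Sum>j\<in>UNIV. L v $ j * partial_deriv j f (L x + z))) (at x)"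
proof -
  have "((\<lambda>x. L x + z) has_derivative L) (at x)"
    using assms(2) by (auto intro!: derivative_eq_intros bounded_linear_imp_has_derivative simp: linear_linear)
  from has_derivative_compose[OF this has_derivative_partial_deriv[OF assms(1)]]
  show ?thesis .
qed

lemma partial_deriv_affine:
  fixes f :: "real^'n \<Rightarrow> real" and L :: "real^'m \<Rightarrow> real^'n"
  assumes "f differentiable (at (L x + z))" "linear L"
  shows "partial_deriv i (\<lambda>x. f (L x + z)) x
    = (\<Sum>j\<in>UNIV. L (axis i 1) $ j * partial_deriv j f (L x + z))"
  by (rule partial_deriv_eqI[OF has_derivative_affine_compose[OF assms]])

text \<open>By the chain rule each partial derivative is a combination, with constant coefficients,
  of partial derivatives of f composed with the same affine map. The induction therefore has to vary
  f.\<close>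

lemma C_k_affine:
  fixes f :: "real^'n \<Rightarrow> real" and L :: "real^'m \<Rightarrow> real^'n"
  assumes "C_k k f" and L: "linear L"
  shows "C_k k (\<lambda>x. f (L x + z))"
  using assms(1)
proof (induction k arbitrary: f)
  case 0
  have "continuous_on UNIV (\<lambda>x. L x + z)"
    using L by (intro continuous_intros linear_continuous_on) (simp add: linear_linear)
  then show ?case using 0 by (auto intro: continuous_on_compose2)
next
  case (Suc k)
  have d: "f differentiable (at x)" for x using Suc.prems by simp
  have "partial_deriv i (\<lambda>x. f (L x + z))
      = (\<lambda>x. \<Sum>j\<in>UNIV. L (axis i 1) $ j * partial_deriv j f (L x + z))" for i
    by (rule ext) (rule partial_deriv_affine[OF d L])
  moreover have "(\<lambda>x. f (L x + z)) differentiable (at x)" for x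
    using has_derivative_affine_compose[OF d L] by (auto simp: differentiable_def)
  ultimately show ?case using Suc by (auto intro!: C_k_sum C_k_mult C_k_const)
qed

section \<open>Smooth bumps on boxes, built from exp (-1/t)\<close>

definition flat_exp :: "nat \<Rightarrow> real \<Rightarrow> real" where
  "flat_exp m t = (if t \<le> 0 then 0 else inverse t ^ m * exp (- inverse t))"

text \<open>The family is closed under differentiation, which makes every member smooth.\<close>
lemma flat_exp_has_derivative:
  "(flat_exp m has_real_derivative flat_exp (m + 2) t - real m * flat_exp (Suc m) t) (at t)"
proof (cases t "0 :: real" rule: linorder_cases)
  case less
  have "((\<lambda>_. 0) has_real_derivative 0) (at t)" by simp
  then show ?thesis using less
    by (subst has_field_derivative_cong_ev[where g="\<lambda>_. 0" and y=t])
      (auto simp: flat_exp_def intro!: eventually_mono[OF eventually_nhds_in_open[of "{..<0}" t]])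
next
  case equal
  \<comment> \<open>To the right of 0 the difference quotient is (1/h)^(m+1) / exp (1/h), where the
    exponential outgrows the power; to the left it is 0.\<close>
  have "((\<lambda>h. flat_exp m h / h) \<longlongrightarrow> 0) (at_right 0)"
  proof -
    have "((\<lambda>h. inverse h ^ Suc m / exp (inverse h)) \<longlongrightarrow> 0) (at_right (0::real))"
      by (rule filterlim_compose[OF tendsto_power_div_exp_0 filterlim_inverse_at_top_right])
    then show ?thesis
      by (rule Lim_transform_eventually)
        (auto simp: flat_exp_def eventually_at_filter divide_inverse exp_minus)
  qed
  moreover have "((\<lambda>h. flat_exp m h / h) \<longlongrightarrow> 0) (at_left 0)"
    by (rule Lim_transform_eventually[OF tendsto_const])
      (auto simp: flat_exp_def eventually_at_filter)
  ultimately have "((\<lambda>h. flat_exp m h / h) \<longlongrightarrow> 0) (at 0)"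
    by (simp add: filterlim_split_at)
  then show ?thesis using equal by (simp add: DERIV_def flat_exp_def)
next
  case greater
  have "((\<lambda>t. inverse t ^ m * exp (- inverse t)) has_real_derivative
      real m * inverse t ^ (m - 1) * (- (inverse t * inverse t)) * exp (- inverse t)
      + inverse t ^ m * (exp (- inverse t) * (inverse t * inverse t))) (at t)"
    using greater by (auto intro!: derivative_eq_intros)
  also have "real m * inverse t ^ (m - 1) * (- (inverse t * inverse t)) * exp (- inverse t)
      + inverse t ^ m * (exp (- inverse t) * (inverse t * inverse t))
    = flat_exp (m + 2) t - real m * flat_exp (Suc m) t"
    using greater by (cases m) (simp_all add: flat_exp_def algebra_simps)
  finally have "((\<lambda>t. inverse t ^ m * exp (- inverse t)) has_real_derivative
      flat_exp (m + 2) t - real m * flat_exp (Suc m) t) (at t)" .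
  then show ?thesis using greater
    by (subst has_field_derivative_cong_ev[where g="\<lambda>t. inverse t ^ m * exp (- inverse t)" and y=t])
      (auto simp: flat_exp_def intro!: eventually_mono[OF eventually_nhds_in_open[of "{0<..}" t]])
qed

text \<open>The affine argument, with slope of either sign, serves both faces of a box in direction
  i. The index m must vary in the induction because differentiation raises it.\<close>

lemma C_k_flat_exp: "C_k k (\<lambda>x::real^'n. flat_exp m (c * x $ i + d))"
proof (induction k arbitrary: m)
  have *: "((\<lambda>x::real^'n. flat_exp m (c * x $ i + d)) has_derivative
     (\<lambda>v. (flat_exp (m + 2) (c * x $ i + d) - real m * flat_exp (Suc m) (c * x $ i + d)) * (c * v $ i))) (at x)"
    for m x
    by (rule has_derivative_compose[OF _ flat_exp_has_derivative[unfolded has_field_derivative_def]])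
      (auto intro!: derivative_eq_intros bounded_linear_imp_has_derivative[OF bounded_linear_vec_nth])
  {
    case 0
    show ?case
      using * by (auto simp: continuous_on_eq_continuous_at intro: has_derivative_continuous)
  next
    case (Suc k)
    have "partial_deriv j (\<lambda>x::real^'n. flat_exp m (c * x $ i + d)) =
       (\<lambda>x. (flat_exp (m + 2) (c * x $ i + d) + - real m * flat_exp (Suc m) (c * x $ i + d)) * (c * axis j 1 $ i))" for j
      using partial_deriv_eqI[OF *] by (auto simp: fun_eq_iff)
    then show ?case
      using Suc.IH differentiableI[OF *] by (simp only: C_k.simps) (intro conjI allI C_k_mult C_k_add C_k_const; simp)
  }
qed

lemma flat_exp_0: "flat_exp 0 t = (if t \<le> 0 then 0 else exp (- inverse t))"
  by (simp add: flat_exp_def)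

lemma test_function_C_k: "\<phi> \<in> test_functions \<Longrightarrow> C_k k \<phi>"
  by (simp add: test_functions_def)

lemma test_functions_continuous: "\<phi> \<in> test_functions \<Longrightarrow> continuous_on A \<phi>"
  using test_function_C_k[of \<phi> 0] by (auto intro: continuous_on_subset)

lemma test_functions_differentiable: "\<phi> \<in> test_functions \<Longrightarrow> \<phi> differentiable (at x)"
  using test_function_C_k[of \<phi> "Suc 0"] by (simp only: C_k.simps)

lemma test_functionI:
  assumes "\<And>k. C_k k \<phi>" "compact K" "\<And>x. x \<notin> K \<Longrightarrow> \<phi> x = 0"
  shows "\<phi> \<in> test_functions"
proof -
  have "closure {x. \<phi> x \<noteq> 0} \<subseteq> K"
    using assms(2,3) by (intro closure_minimal) (auto intro: compact_imp_closed)
  then have "compact (closure {x. \<phi> x \<noteq> 0})"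
    using assms(2) by (metis bounded_subset closed_closure compact_eq_bounded_closed)
  then show ?thesis using assms(1) by (simp add: test_functions_def)
qed

lemma test_function_support:
  assumes "\<phi> \<in> test_functions"
  obtains K where "compact K" "\<And>x. x \<notin> K \<Longrightarrow> \<phi> x = 0"
proof (rule that)
  show "compact (closure {x. \<phi> x \<noteq> 0})"
    using assms by (simp add: test_functions_def)
  show "\<phi> x = 0" if "x \<notin> closure {x. \<phi> x \<noteq> 0}" for x
    using that closure_subset[of "{x. \<phi> x \<noteq> 0}"] by auto
qed

lemma test_function_partial_deriv:
  assumes "\<phi> \<in> test_functions"
  shows "partial_deriv i \<phi> \<in> test_functions"
proof -
  have "partial_deriv i \<phi> x = 0" if "x \<notin> closure {x. \<phi> x \<noteq> 0}" for x
  proof -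
    have "(\<phi> has_derivative (\<lambda>_. 0)) (at x)"
      using that closure_subset[of "{x. \<phi> x \<noteq> 0}"]
      by (intro has_derivative_transform_within_open[OF has_derivative_const[of 0],
            where s="- closure {x. \<phi> x \<noteq> 0}"]) auto
    then show ?thesis by (rule partial_deriv_eqI)
  qed
  moreover have "C_k k (partial_deriv i \<phi>)" for k
    using test_function_C_k[OF assms, of "Suc k"] by (simp only: C_k.simps)
  ultimately show ?thesis
    using assms by (intro test_functionI[where K="closure {x. \<phi> x \<noteq> 0}"]) (auto simp: test_functions_def)
qed

lemma test_function_mult:
  assumes "\<phi> \<in> test_functions" "\<And>k. C_k k f"
  shows "(\<lambda>x. f x * \<phi> x) \<in> test_functions"
proof -
  obtain K where "compact K" "\<And>x. x \<notin> K \<Longrightarrow> \<phi> x = 0"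
    using test_function_support[OF assms(1)] by blast
  then show ?thesis
    using assms by (intro test_functionI[of _ K] C_k_mult) (auto simp: test_functions_def)
qed

lemma partial_deriv_mult:
  assumes "f differentiable (at x)" "g differentiable (at x)"
  shows "partial_deriv i (\<lambda>x. f x * g x) x = f x * partial_deriv i g x + partial_deriv i f x * g x"
  using partial_deriv_eqI[OF has_derivative_mult[OF assms[unfolded frechet_derivative_works]]]
  by (simp add: partial_deriv_def)

text \<open>The parameter k is a steepness: for t > 0 the factor exp (-1/(k t)) tends to 1 as k
  grows, so the bumps converge pointwise to the indicator of the open box, staying between 0 and
  that indicator.\<close>

definition box_bump :: "real^'n \<Rightarrow> real^'n \<Rightarrow> real \<Rightarrow> real^'n \<Rightarrow> real" where
  "box_bump a b k x = (\<Prod>i\<in>UNIV. flat_exp 0 (k * (x $ i - a $ i)) * flat_exp 0 (k * (b $ i - x $ i)))"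

lemma box_bump_test_function:
  assumes "k > 0"
  shows "box_bump a b k \<in> test_functions"
proof (rule test_functionI)
  have "C_k m (\<lambda>x. flat_exp 0 (k * (x $ i - a $ i)) * flat_exp 0 (k * (b $ i - x $ i)))" for m i
    using C_k_mult[OF C_k_flat_exp[of m 0 k i "- k * a $ i"] C_k_flat_exp[of m 0 "- k" i "k * b $ i"]]
    by (simp add: algebra_simps)
  then show "C_k m (box_bump a b k)" for m
    unfolding box_bump_def by (intro C_k_prod)
  show "compact (cbox a b)" by simp
  fix x assume "x \<notin> cbox a b"
  then obtain i where "x $ i < a $ i \<or> b $ i < x $ i"
    by (auto simp: mem_box_cart not_le)
  then show "box_bump a b k x = 0"
    unfolding box_bump_def using assms
    by (intro prod_zero) (auto intro!: exI[of _ i] simp: flat_exp_def mult_le_0_iff)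
qed

lemma box_bump_bounds: "0 \<le> box_bump a b k x" "box_bump a b k x \<le> 1"
proof -
  have "0 \<le> flat_exp 0 t \<and> flat_exp 0 t \<le> 1" for t
    by (simp add: flat_exp_0)
  then show "0 \<le> box_bump a b k x" "box_bump a b k x \<le> 1"
    unfolding box_bump_def by (auto intro!: prod_nonneg prod_le_1 mult_le_one)
qed

lemma box_bump_eq_0: "k > 0 \<Longrightarrow> x \<notin> box a b \<Longrightarrow> box_bump a b k x = 0"
  unfolding box_bump_def
  by (rule prod_zero) (auto simp: mem_box_cart flat_exp_def mult_le_0_iff not_less)

lemma box_bump_tendsto:
  "(\<lambda>k. box_bump a b (real (Suc k)) x) \<longlonglongrightarrow> indicator (box a b) x"
proof (cases "x \<in> box a b")
  case True
  have "(\<lambda>k. flat_exp 0 (real (Suc k) * t)) \<longlonglongrightarrow> 1" if "t > 0" for t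
  proof -
    have "(\<lambda>k. exp (- (inverse (real (Suc k)) * inverse t))) \<longlonglongrightarrow> exp (- (0 * inverse t))"
      by (intro tendsto_intros LIMSEQ_inverse_real_of_nat)
    then show ?thesis using that by (simp add: flat_exp_0 mult_le_0_iff not_le)
  qed
  then have "(\<lambda>k. box_bump a b (real (Suc k)) x) \<longlonglongrightarrow> (\<Prod>i\<in>(UNIV::'a set). 1 * 1)"
    unfolding box_bump_def using True by (intro tendsto_intros) (auto simp: mem_box_cart)
  then show ?thesis using True by simp
next
  case False
  then show ?thesis by (simp add: box_bump_eq_0)
qed

text \<open>Open boxes generate the Borel sets, are stable under intersection and exhaust the space.
  The measure of a box is the limit of the integrals of its bumps, by dominated convergence with the
  indicator of the box as majorant. The lemma serves twice: for the Jordan parts of a signed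
  measure, and for densities of locally integrable functions.\<close>

lemma measure_eqI_test_functions:
  fixes M N :: "(real^'n) measure"
  assumes sets [measurable_cong]: "sets M = sets borel" "sets N = sets borel"
    and fin: "\<And>a b. emeasure M (box a b) < \<infinity>" "\<And>a b. emeasure N (box a b) < \<infinity>"
    and eq: "\<And>\<phi>. \<phi> \<in> test_functions \<Longrightarrow> (LINT x|M. \<phi> x) = (LINT x|N. \<phi> x)"
  shows "M = N"
proof (rule measure_eqI_generator_eq)
  let ?E = "range (\<lambda>(a, b). box a b :: (real^'n) set)"
  show "Int_stable ?E"
    by (auto simp: Int_stable_def box_Int_box)
  show "?E \<subseteq> Pow UNIV" "sets M = sigma_sets UNIV ?E" "sets N = sigma_sets UNIV ?E"
    by (simp_all add: borel_eq_box sets)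
  let ?A = "\<lambda>n::nat. box (- (real n *\<^sub>R One)) (real n *\<^sub>R One) :: (real^'n) set"
  show "range ?A \<subseteq> ?E" "(\<Union>i. ?A i) = UNIV"
    unfolding UN_box_eq_UNIV by auto
  show "emeasure M (?A i) \<noteq> \<infinity>" for i using fin(1) by (simp add: less_top)
  have lim: "(\<lambda>k. LINT x|M. box_bump a b (real (Suc k)) x) \<longlonglongrightarrow> measure M (box a b)"
    if sets [measurable_cong]: "sets M = sets borel" and fin: "emeasure M (box a b) < \<infinity>"
    for M :: "(real^'n) measure" and a b
  proof -
    have sp: "space M = UNIV" using sets_eq_imp_space_eq[OF sets] by simp
    have meas: "box_bump a b (real (Suc k)) \<in> borel_measurable M" for k
      unfolding measurable_cong_sets[OF sets refl]
      by (intro borel_measurable_continuous_onI test_functions_continuous box_bump_test_function) simp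
    have ind: "integrable M (indicator (box a b) :: _ \<Rightarrow> real)"
      using fin sets by (simp add: integrable_indicator_iff)
    have "norm (box_bump a b (real (Suc k)) x) \<le> indicator (box a b) x" for k x
      using box_bump_bounds[of a b "real (Suc k)" x] box_bump_eq_0[of "real (Suc k)" x a b]
      by (cases "x \<in> box a b") (auto simp del: of_nat_Suc)
    moreover have "indicator (box a b) \<in> borel_measurable M"
      by (simp add: sets)
    ultimately have "(\<lambda>k. LINT x|M. box_bump a b (real (Suc k)) x) \<longlonglongrightarrow> (LINT x|M. indicator (box a b) x)"
      by (intro integral_dominated_convergence[where w="indicator (box a b)"] AE_I2 ind box_bump_tendsto meas)
    then show ?thesis using sp by simp
  qed
  show "emeasure M X = emeasure N X" if X_box: "X \<in> ?E" for X
  proof -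
    obtain a b where X: "X = box a b" using X_box by auto
    have "(LINT x|M. box_bump a b (real (Suc k)) x) = (LINT x|N. box_bump a b (real (Suc k)) x)" for k
      by (intro eq box_bump_test_function) simp
    then have "measure M X = measure N X"
      unfolding X using LIMSEQ_unique[OF lim[OF sets(1) fin(1)]] lim[OF sets(2) fin(2)] by presburger
    then show ?thesis
      using fin unfolding X by (simp add: emeasure_eq_ennreal_measure less_top)
  qed
qed

section \<open>Locally integrable functions tested against smooth functions\<close>

lemma locally_integrable_mult:
  fixes g :: "real^'n \<Rightarrow> real"
  assumes g: "locally_integrable g" and \<phi>: "continuous_on UNIV \<phi>"
    and K: "compact K" "\<And>x. x \<notin> K \<Longrightarrow> \<phi> x = 0"
  shows "integrable lborel (\<lambda>x. g x * \<phi> x)"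
proof -
  have "bounded (\<phi> ` K)"
    using K \<phi> by (meson compact_continuous_image compact_imp_bounded continuous_on_subset subset_UNIV)
  then obtain B where "\<And>x. x \<in> K \<Longrightarrow> \<bar>\<phi> x\<bar> \<le> B"
    by (auto simp: bounded_iff)
  then have B: "\<bar>\<phi> x\<bar> \<le> \<bar>B\<bar>" for x
    using K(2)[of x] by (cases "x \<in> K") fastforce+
  have g': "integrable lborel (\<lambda>x. indicator K x * g x)"
    using g K(1) by (auto simp: locally_integrable_def set_integrable_def)
  have [measurable]: "\<phi> \<in> borel_measurable borel"
    using \<phi> by (rule borel_measurable_continuous_onI)
  have eq: "g x * \<phi> x = \<phi> x * (indicator K x * g x)" for x
    using K(2)[of x] by (auto simp: indicator_def)
  show ?thesis
    unfolding eq
  proof (rule Bochner_Integration.integrable_bound)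
    show "integrable lborel (\<lambda>x. \<bar>B\<bar> * (indicator K x * g x))"
      using g' by simp
    show "(\<lambda>x. \<phi> x * (indicator K x * g x)) \<in> borel_measurable lborel"
      using borel_measurable_integrable[OF g'] by measurable
    show "AE x in lborel. norm (\<phi> x * (indicator K x * g x)) \<le> norm (\<bar>B\<bar> * (indicator K x * g x))"
      using B by (auto simp: abs_mult intro!: mult_right_mono)
  qed
qed

lemma locally_integrable_test:
  assumes "locally_integrable g" "\<phi> \<in> test_functions"
  shows "integrable lborel (\<lambda>x. g x * \<phi> x)"
proof -
  obtain K where "compact K" "\<And>x. x \<notin> K \<Longrightarrow> \<phi> x = 0"
    using test_function_support[OF assms(2)] by blast
  then show ?thesis
    by (intro locally_integrable_mult[OF assms(1) test_functions_continuous[OF assms(2)]])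
qed

lemma locally_integrable_borel_measurable:
  fixes g :: "real^'n \<Rightarrow> real"
  assumes g: "locally_integrable g"
  shows "g \<in> borel_measurable borel"
proof (rule borel_measurable_LIMSEQ_real)
  show "(\<lambda>x. indicator (cball 0 (real i)) x * g x) \<in> borel_measurable borel" for i
    using g[unfolded locally_integrable_def, rule_format, of "cball 0 (real i)"]
    by (auto simp: set_integrable_def dest!: borel_measurable_integrable)
  fix x :: "real^'n"
  obtain n where "norm x \<le> real n" using real_arch_simple by blast
  then have "eventually (\<lambda>i. indicator (cball 0 (real i)) x * g x = g x) sequentially"
    by (intro eventually_sequentiallyI[of n]) (auto simp: indicator_def)
  then show "(\<lambda>i. indicator (cball 0 (real i)) x * g x) \<longlonglongrightarrow> g x"
    by (rule tendsto_eventually)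
qed

lemma continuous_imp_locally_integrable:
  assumes "continuous_on UNIV f"
  shows "locally_integrable f"
  unfolding locally_integrable_def set_integrable_def
  by (intro allI impI borel_integrable_compact continuous_on_subset[OF assms]) auto

lemma locally_integrable_add:
  "locally_integrable f \<Longrightarrow> locally_integrable g \<Longrightarrow> locally_integrable (\<lambda>x. f x + g x)"
  unfolding locally_integrable_def by (auto intro: set_integral_add)

lemma locally_integrable_cmult:
  "locally_integrable f \<Longrightarrow> locally_integrable (\<lambda>x. c * f x)"
  unfolding locally_integrable_def by auto

text \<open>The positive and negative parts of g are read as densities. The hypothesis says that the
  two measures agree on test functions, so they coincide, and so do the densities almost everywhere.
  At each point one of the two parts is 0, hence both are.\<close>

lemma fundamental_lemma_of_variations:
  fixes g :: "real^'n \<Rightarrow> real"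
  assumes g: "locally_integrable g" and 0: "\<And>\<phi>. \<phi> \<in> test_functions \<Longrightarrow> (LINT x|lborel. g x * \<phi> x) = 0"
  shows "AE x in lborel. g x = 0"
proof -
  note [measurable] = locally_integrable_borel_measurable[OF g]
  define gp where "gp x = max 0 (g x)" for x
  define gm where "gm x = max 0 (- g x)" for x
  have [measurable]: "gp \<in> borel_measurable borel" "gm \<in> borel_measurable borel"
    unfolding gp_def gm_def by measurable
  have fin: "emeasure (density lborel h) (box a b) < \<infinity>"
    if h [measurable]: "h \<in> borel_measurable borel" and hg: "\<And>x. h x \<ge> 0" "\<And>x. h x \<le> \<bar>g x\<bar>" for h a b
  proof -
    have "integrable lborel (\<lambda>x. indicator (cbox a b) x * g x)"
      using g compact_cbox[of a b] by (auto simp: locally_integrable_def set_integrable_def)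
    then have "(\<integral>\<^sup>+x. ennreal (norm (indicator (cbox a b) x * g x)) \<partial>lborel) < \<infinity>"
      by (simp add: integrable_iff_bounded)
    moreover have "emeasure (density lborel h) (box a b) \<le> (\<integral>\<^sup>+x. ennreal (norm (indicator (cbox a b) x * g x)) \<partial>lborel)"
      using hg box_subset_cbox[of a b]
      by (auto simp: emeasure_density indicator_def abs_mult intro!: nn_integral_mono)
    ultimately show ?thesis by simp
  qed
  have int: "integrable lborel (\<lambda>x. h x * \<phi> x)"
    if h [measurable]: "h \<in> borel_measurable borel" and hg: "\<And>x. h x \<ge> 0" "\<And>x. h x \<le> \<bar>g x\<bar>"
      and \<phi>: "\<phi> \<in> test_functions" for h \<phi>
  proof (rule Bochner_Integration.integrable_bound[OF locally_integrable_test[OF g \<phi>]])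
    have [measurable]: "\<phi> \<in> borel_measurable borel"
      using \<phi> by (intro borel_measurable_continuous_onI test_functions_continuous)
    show "(\<lambda>x. h x * \<phi> x) \<in> borel_measurable lborel" by measurable
    show "AE x in lborel. norm (h x * \<phi> x) \<le> norm (g x * \<phi> x)"
      using hg by (auto simp: abs_mult intro!: mult_right_mono)
  qed
  have "density lborel gp = density lborel gm"
  proof (rule measure_eqI_test_functions)
    fix \<phi> :: "real^'n \<Rightarrow> real" assume \<phi>: "\<phi> \<in> test_functions"
    have [measurable]: "\<phi> \<in> borel_measurable borel"
      using \<phi> by (intro borel_measurable_continuous_onI test_functions_continuous)
    have "(LINT x|lborel. gp x * \<phi> x) - (LINT x|lborel. gm x * \<phi> x) = (LINT x|lborel. gp x * \<phi> x - gm x * \<phi> x)"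
      using \<phi> by (intro Bochner_Integration.integral_diff[symmetric] int) (auto simp: gp_def gm_def)
    also have "(\<lambda>x. gp x * \<phi> x - gm x * \<phi> x) = (\<lambda>x. g x * \<phi> x)"
      by (auto simp: gp_def gm_def fun_eq_iff max_def)
    finally show "(LINT x|density lborel gp. \<phi> x) = (LINT x|density lborel gm. \<phi> x)"
      using 0[OF \<phi>] by (simp add: integral_density gp_def gm_def)
  qed (use fin[of gp] fin[of gm] in \<open>auto simp: gp_def gm_def\<close>)
  then have "AE x in lborel. ennreal (gp x) = ennreal (gm x)"
    by (subst (asm) sigma_finite_measure.density_unique_iff[OF sigma_finite_lborel]) auto
  then show ?thesis
    by eventually_elim (auto simp: gp_def gm_def max_def split: if_splits)
qed

text \<open>This makes the arbitrary choice of versions in \<open>weak_grad\<close> harmless under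
  the integral sign.\<close>

lemma has_weak_partial_unique:
  assumes "has_weak_partial u i g" "has_weak_partial u i h"
  shows "AE x in lborel. g x = h x"
proof -
  have li: "locally_integrable g" "locally_integrable h"
    using assms by (auto simp: has_weak_partial_def)
  have "AE x in lborel. g x + (-1) * h x = 0"
  proof (rule fundamental_lemma_of_variations)
    show "locally_integrable (\<lambda>x. g x + (-1) * h x)"
      using li by (intro locally_integrable_add locally_integrable_cmult)
    fix \<phi> assume \<phi>: "\<phi> \<in> (test_functions :: (real^'a \<Rightarrow> real) set)"
    have "(LINT x|lborel. g x * \<phi> x) = (LINT x|lborel. h x * \<phi> x)"
      using assms \<phi> by (auto simp: has_weak_partial_def)
    moreover have "(LINT x|lborel. g x * \<phi> x - h x * \<phi> x) = (LINT x|lborel. g x * \<phi> x) - (LINT x|lborel. h x * \<phi> x)"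
      using li \<phi> by (intro Bochner_Integration.integral_diff locally_integrable_test)
    ultimately show "(LINT x|lborel. (g x + (-1) * h x) * \<phi> x) = 0"
      by (simp add: algebra_simps)
  qed
  then show ?thesis by eventually_elim simp
qed

section \<open>Differentiation under the integral\<close>

lemma C_k_translate: "C_k k f \<Longrightarrow> C_k k (\<lambda>x. f (x + z))"
  using C_k_affine[of k f "\<lambda>x. x" z] by (simp add: linear_id[unfolded id_def])

lemma test_function_translate:
  assumes "\<phi> \<in> test_functions"
  shows "(\<lambda>x. \<phi> (x + z)) \<in> test_functions"
proof -
  obtain K where K: "compact K" "\<And>x. x \<notin> K \<Longrightarrow> \<phi> x = 0"
    using test_function_support[OF assms] by blast
  show ?thesis
  proof (rule test_functionI)
    show "C_k k (\<lambda>x. \<phi> (x + z))" for k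
      using assms by (intro C_k_translate test_function_C_k)
    show "compact ((\<lambda>x. - z + x) ` K)"
      using K(1) by (rule compact_translation)
    show "\<phi> (x + z) = 0" if "x \<notin> (\<lambda>x. - z + x) ` K" for x
      using that K(2)[of "x + z"] by (force simp: image_iff)
  qed
qed

lemma partial_deriv_translate:
  fixes \<phi> :: "real^'n \<Rightarrow> real"
  assumes "\<phi> \<in> test_functions"
  shows "partial_deriv i (\<lambda>x. \<phi> (x + z)) x = partial_deriv i \<phi> (x + z)"
proof -
  have "(\<Sum>j\<in>UNIV. axis i 1 $ j * partial_deriv j \<phi> (x + z)) = partial_deriv i \<phi> (x + z)"
    by (simp add: axis_def if_distrib[of "\<lambda>t. t * _"] cong: if_cong)
  then show ?thesis
    using partial_deriv_affine[OF test_functions_differentiable[OF assms], where L="\<lambda>x. x" and x=x and z=z and i=i]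
    by (simp add: linear_id[unfolded id_def])
qed

lemma test_function_line_derivative:
  fixes \<phi> :: "real^'n \<Rightarrow> real"
  assumes "\<phi> \<in> test_functions"
  shows "((\<lambda>s. \<phi> (x + s *\<^sub>R axis i 1)) has_real_derivative partial_deriv i \<phi> (x + s *\<^sub>R axis i 1)) (at s)"
proof -
  have "((\<lambda>s. \<phi> (x + s *\<^sub>R axis i 1)) has_derivative
    (\<lambda>t. \<Sum>j\<in>UNIV. (t *\<^sub>R axis i 1) $ j * partial_deriv j \<phi> (x + s *\<^sub>R axis i 1))) (at s)"
    by (rule has_derivative_compose[OF _ has_derivative_partial_deriv[OF test_functions_differentiable[OF assms]]])
      (auto intro!: derivative_eq_intros)
  moreover have "(\<lambda>t. \<Sum>j\<in>UNIV. (t *\<^sub>R axis i 1) $ j * partial_deriv j \<phi> y) = (*) (partial_deriv i \<phi> y)" for y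
    by (simp add: fun_eq_iff axis_def if_distrib[of "\<lambda>t. t * _"] if_distrib[of "\<lambda>t. _ * t"] cong: if_cong)
  ultimately show ?thesis by (simp only: has_field_derivative_def)
qed

text \<open>The shift acts on the test function, so u need not be differentiable. With u = 1 this
  yields integration by parts without iterated integrals; with a u of zero weak gradient it yields
  translation invariance of u.\<close>

lemma translated_integral_has_derivative:
  fixes u \<phi> :: "real^'n \<Rightarrow> real"
  assumes u: "continuous_on UNIV u" and \<phi>: "\<phi> \<in> test_functions"
  shows "((\<lambda>s. LINT x|lborel. u x * \<phi> (x + s *\<^sub>R axis i 1)) has_real_derivative
    (LINT x|lborel. u x * partial_deriv i \<phi> (x + s *\<^sub>R axis i 1))) (at s)"
proof -
  define e where "e = (axis i 1 :: real^'n)"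
  define U where "U = {s - 1<..<s + 1}"
  obtain K where K: "compact K" "\<And>x. x \<notin> K \<Longrightarrow> \<phi> x = 0"
    using test_function_support[OF \<phi>] by blast
  obtain K' where K': "compact K'" "\<And>x. x \<notin> K' \<Longrightarrow> partial_deriv i \<phi> x = 0"
    using test_function_support[OF test_function_partial_deriv[OF \<phi>, of i]] by blast
  have "bounded (K \<union> K')" using K K' by (simp add: compact_imp_bounded)
  then obtain B where B: "\<And>x. x \<in> K \<union> K' \<Longrightarrow> norm x \<le> B"
    by (auto simp: bounded_iff)
  \<comment> \<open>B bounds the supports of \<open>\<phi>\<close> and of its derivative, and a
    shift with parameter in U moves a point by at most |s| + 1. Outside the box all integrands with
    parameter in U vanish, so the Leibniz rule can be applied on a single compact box.\<close>
  obtain a where a: "cball 0 (B + \<bar>s\<bar> + 1) \<subseteq> cbox (-a) (a::real^'n)"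
    using bounded_subset_cbox_symmetric[OF bounded_cball] by blast
  have out: "x + t *\<^sub>R e \<notin> K \<union> K'" if "t \<in> U" "x \<notin> cbox (-a) a" for t x
  proof
    assume "x + t *\<^sub>R e \<in> K \<union> K'"
    then have "norm (x + t *\<^sub>R e) \<le> B" by (rule B)
    moreover have "norm (t *\<^sub>R e) \<le> \<bar>s\<bar> + 1"
      using that by (auto simp: U_def e_def norm_axis_1)
    moreover have "norm x \<le> norm (x + t *\<^sub>R e) + norm (t *\<^sub>R e)"
      using norm_triangle_ineq4[of "x + t *\<^sub>R e" "t *\<^sub>R e"] by simp
    ultimately have "x \<in> cball 0 (B + \<bar>s\<bar> + 1)" by simp
    then show False using a that by blast
  qed
  have eq: "(LINT x|lborel. u x * \<psi> (x + t *\<^sub>R e)) = integral (cbox (-a) a) (\<lambda>x. u x * \<psi> (x + t *\<^sub>R e))"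
    and int: "(\<lambda>x. u x * \<psi> (x + t *\<^sub>R e)) integrable_on cbox (-a) a"
    if "t \<in> U" "\<psi> \<in> test_functions" "\<And>x. x \<notin> K \<union> K' \<Longrightarrow> \<psi> x = 0" for t \<psi>
  proof -
    have "integrable lborel (\<lambda>x. u x * \<psi> (x + t *\<^sub>R e))"
      using that by (intro locally_integrable_test[OF continuous_imp_locally_integrable[OF u]] test_function_translate)
    then have "((\<lambda>x. u x * \<psi> (x + t *\<^sub>R e)) has_integral (LINT x|lborel. u x * \<psi> (x + t *\<^sub>R e))) UNIV"
      by (rule has_integral_integral_lborel)
    moreover have eq: "(\<lambda>x. u x * \<psi> (x + t *\<^sub>R e)) = (\<lambda>x. if x \<in> cbox (-a) a then u x * \<psi> (x + t *\<^sub>R e) else 0)"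
      using out that by (auto simp: fun_eq_iff)
    ultimately have *: "((\<lambda>x. u x * \<psi> (x + t *\<^sub>R e)) has_integral (LINT x|lborel. u x * \<psi> (x + t *\<^sub>R e))) (cbox (-a) a)"
      using arg_cong[OF eq, of "\<lambda>f. (f has_integral (LINT x|lborel. u x * \<psi> (x + t *\<^sub>R e))) UNIV"]
      by (simp only: has_integral_restrict_UNIV)
    then show "(LINT x|lborel. u x * \<psi> (x + t *\<^sub>R e)) = integral (cbox (-a) a) (\<lambda>x. u x * \<psi> (x + t *\<^sub>R e))"
      "(\<lambda>x. u x * \<psi> (x + t *\<^sub>R e)) integrable_on cbox (-a) a"
      by (auto simp: has_integral_integrable integral_unique)
  qed
  have d\<phi>: "continuous_on UNIV (partial_deriv i \<phi>)"
    by (intro test_functions_continuous test_function_partial_deriv \<phi>)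
  have sU: "s \<in> U" "open U" by (auto simp: U_def)
  have "((\<lambda>s. integral (cbox (-a) a) (\<lambda>x. u x * \<phi> (x + s *\<^sub>R e))) has_real_derivative
      integral (cbox (-a) a) (\<lambda>x. u x * partial_deriv i \<phi> (x + s *\<^sub>R e))) (at s within U)"
  proof (rule leibniz_rule_field_derivative)
    show "((\<lambda>s. u x * \<phi> (x + s *\<^sub>R e)) has_real_derivative u x * partial_deriv i \<phi> (x + t *\<^sub>R e)) (at t within U)" for t x
      unfolding e_def
      by (intro DERIV_cmult has_field_derivative_at_within[OF test_function_line_derivative[OF \<phi>]])
    show "(\<lambda>x. u x * \<phi> (x + t *\<^sub>R e)) integrable_on cbox (-a) a" if "t \<in> U" for t
      using that \<phi> K(2) by (intro int) auto
    show "continuous_on (U \<times> cbox (-a) a) (\<lambda>(t, x). u x * partial_deriv i \<phi> (x + t *\<^sub>R e))"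
      unfolding case_prod_beta
      by (intro continuous_intros continuous_on_compose2[OF u] continuous_on_compose2[OF d\<phi>]) auto
  qed (auto simp: U_def)
  moreover have "integral (cbox (-a) a) (\<lambda>x. u x * partial_deriv i \<phi> (x + s *\<^sub>R e)) =
      (LINT x|lborel. u x * partial_deriv i \<phi> (x + s *\<^sub>R e))"
    using K'(2) sU by (intro eq[symmetric] test_function_partial_deriv \<phi>) auto
  ultimately have "((\<lambda>s. integral (cbox (-a) a) (\<lambda>x. u x * \<phi> (x + s *\<^sub>R e))) has_real_derivative
      (LINT x|lborel. u x * partial_deriv i \<phi> (x + s *\<^sub>R e))) (at s)"
    by (simp only: at_within_open[OF sU])
  then show ?thesis
    unfolding e_def[symmetric]
    by (rule has_field_derivative_transform_within_open[OF _ sU(2,1)])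
      (rule eq[OF _ \<phi> K(2), symmetric], auto)
qed

lemma lborel_integral_translate:
  fixes f :: "real^'n \<Rightarrow> real"
  assumes [measurable]: "f \<in> borel_measurable borel"
  shows "(LINT x|lborel. f (x + z)) = (LINT x|lborel. f x)"
proof -
  have "(LINT x|lborel. f x) = (LINT x|distr lborel borel ((+) z). f x)"
    by (simp add: lborel_distr_plus)
  then show ?thesis by (simp add: integral_distr add.commute)
qed

text \<open>By translation invariance of Lebesgue measure the integral of a shifted test function
  does not depend on the shift; its derivative in the shift parameter is the integral in
  question.\<close>

lemma integral_partial_deriv_test_function:
  fixes \<phi> :: "real^'n \<Rightarrow> real"
  assumes \<phi>: "\<phi> \<in> test_functions"
  shows "(LINT x|lborel. partial_deriv i \<phi> x) = 0"
proof -
  have "((\<lambda>s::real. LINT x|lborel. 1 * \<phi> (x + s *\<^sub>R axis i 1)) has_real_derivative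
    (LINT x|lborel. 1 * partial_deriv i \<phi> (x + 0 *\<^sub>R axis i 1))) (at 0)"
    by (intro translated_integral_has_derivative \<phi> continuous_intros)
  moreover have "(\<lambda>s::real. LINT x|lborel. 1 * \<phi> (x + s *\<^sub>R axis i 1)) = (\<lambda>s. LINT x|lborel. \<phi> x)"
    using borel_measurable_continuous_onI[OF test_functions_continuous[OF \<phi>]]
    by (simp add: lborel_integral_translate)
  ultimately have "((\<lambda>s::real. LINT x|lborel. \<phi> x) has_real_derivative (LINT x|lborel. partial_deriv i \<phi> x)) (at 0)"
    by simp
  then show ?thesis
    by (rule DERIV_unique) (rule DERIV_const)
qed

text \<open>Integration by parts: the partial derivative of the product of two test functions has
  integral 0.\<close>

lemma test_function_has_weak_partial:
  fixes \<psi> :: "real^'n \<Rightarrow> real"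
  assumes \<psi>: "\<psi> \<in> test_functions"
  shows "has_weak_partial \<psi> i (partial_deriv i \<psi>)"
  unfolding has_weak_partial_def
proof (intro conjI ballI)
  note d\<psi> = test_function_partial_deriv[OF \<psi>, of i]
  show li: "locally_integrable \<psi>" "locally_integrable (partial_deriv i \<psi>)"
    using \<psi> d\<psi> by (auto intro: continuous_imp_locally_integrable test_functions_continuous)
  fix \<phi> :: "real^'n \<Rightarrow> real" assume \<phi>: "\<phi> \<in> test_functions"
  note d\<phi> = test_function_partial_deriv[OF \<phi>, of i]
  have "(\<lambda>x. \<psi> x * \<phi> x) \<in> test_functions"
    by (intro test_function_mult \<phi> test_function_C_k \<psi>)
  then have "(LINT x|lborel. partial_deriv i (\<lambda>x. \<psi> x * \<phi> x) x) = 0"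
    by (rule integral_partial_deriv_test_function)
  also have "partial_deriv i (\<lambda>x. \<psi> x * \<phi> x) = (\<lambda>x. \<psi> x * partial_deriv i \<phi> x + partial_deriv i \<psi> x * \<phi> x)"
    by (intro ext partial_deriv_mult test_functions_differentiable \<phi> \<psi>)
  also have "(LINT x|lborel. \<psi> x * partial_deriv i \<phi> x + partial_deriv i \<psi> x * \<phi> x)
      = (LINT x|lborel. \<psi> x * partial_deriv i \<phi> x) + (LINT x|lborel. partial_deriv i \<psi> x * \<phi> x)"
    by (intro Bochner_Integration.integral_add locally_integrable_test li \<phi> d\<phi>)
  finally show "(LINT x|lborel. \<psi> x * partial_deriv i \<phi> x) = - (LINT x|lborel. partial_deriv i \<psi> x * \<phi> x)"
    by simp
qed

lemma continuous_AE_eq_0: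
  fixes f :: "real^'n \<Rightarrow> real"
  assumes f: "continuous_on UNIV f" and 0: "AE x in lborel. f x = 0"
  shows "f x = 0"
proof (rule ccontr)
  assume x: "f x \<noteq> 0"
  have op: "open {x. f x \<noteq> 0}"
    using f by (intro open_Collect_neq) auto
  then have "{x. f x \<noteq> 0} \<in> sets borel" by simp
  then have "{x. f x \<noteq> 0} \<in> null_sets lborel"
    using 0 by (subst AE_iff_null_sets) (auto elim: eventually_mono)
  then have "negligible {x. f x \<noteq> 0}"
    by (simp add: negligible_iff_null_sets null_sets_completionI)
  then show False using x op open_not_negligible by blast
qed

text \<open>Tested with translates of \<open>\<phi>\<close>, the vanishing weak derivative says that
  the integral of u against a shifted \<open>\<phi>\<close> does not depend on the shift. So u and
  its translates agree almost everywhere, and by continuity everywhere. The origin is then joined to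
  x one coordinate at a time.\<close>

lemma zero_weak_partials_imp_const:
  fixes u :: "real^'n \<Rightarrow> real"
  assumes u: "continuous_on UNIV u" and 0: "\<And>i. has_weak_partial u i (\<lambda>x. 0)"
  shows "u x = u 0"
proof -
  have [measurable]: "u \<in> borel_measurable borel"
    using u by (rule borel_measurable_continuous_onI)
  have shift: "u (x + s *\<^sub>R axis i 1) = u x" for x s i
  proof -
    define z where "z = (s *\<^sub>R axis i 1 :: real^'n)"
    have cont: "continuous_on UNIV (\<lambda>x. u (x + z) + (-1) * u x)"
      by (intro continuous_intros continuous_on_compose2[OF u]) auto
    have "AE x in lborel. u (x + z) + (-1) * u x = 0"
    proof (rule fundamental_lemma_of_variations)
      show "locally_integrable (\<lambda>x. u (x + z) + (-1) * u x)"
        using cont by (rule continuous_imp_locally_integrable)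
      fix \<phi> :: "real^'n \<Rightarrow> real" assume \<phi>: "\<phi> \<in> test_functions"
      have [measurable]: "\<phi> \<in> borel_measurable borel"
        using \<phi> by (intro borel_measurable_continuous_onI test_functions_continuous)
      define H where "H s = (LINT x|lborel. u x * \<phi> (x + s *\<^sub>R axis i 1))" for s
      have "(LINT x|lborel. u x * partial_deriv i \<phi> (x + t *\<^sub>R axis i 1)) = 0" for t
        using 0[of i] test_function_translate[OF \<phi>]
        unfolding has_weak_partial_def partial_deriv_translate[OF \<phi>, symmetric] by simp
      then have "(H has_real_derivative 0) (at t)" for t
        using translated_integral_has_derivative[OF u \<phi>, of i t] unfolding H_def by simp
      then have H: "H (- s) = H 0" using DERIV_isconst_all by blast
      \<comment> \<open>A substitution moves the shift from u to the test function and reverses its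
        sign.\<close>
      have "(LINT x|lborel. u (x + z) * \<phi> x) = (LINT x|lborel. u ((x + z)) * \<phi> ((x + z) - z))"
        by simp
      also have "\<dots> = H (- s)"
        unfolding H_def using lborel_integral_translate[of "\<lambda>x. u x * \<phi> (x - z)" z]
        by (simp add: z_def)
      also have "\<dots> = (LINT x|lborel. u x * \<phi> x)"
        unfolding H by (simp add: H_def)
      finally have "(LINT x|lborel. u (x + z) * \<phi> x) = (LINT x|lborel. u x * \<phi> x)" .
      moreover have "continuous_on UNIV (\<lambda>x. u (x + z))"
        by (intro continuous_intros continuous_on_compose2[OF u]) auto
      then have "(LINT x|lborel. u (x + z) * \<phi> x - u x * \<phi> x)
          = (LINT x|lborel. u (x + z) * \<phi> x) - (LINT x|lborel. u x * \<phi> x)"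
        using u \<phi> by (intro Bochner_Integration.integral_diff locally_integrable_test continuous_imp_locally_integrable)
      ultimately show "(LINT x|lborel. (u (x + z) + (-1) * u x) * \<phi> x) = 0"
        by (simp add: algebra_simps)
    qed
    from continuous_AE_eq_0[OF cont this, of x] show ?thesis by (simp add: z_def)
  qed
  have "u (\<Sum>i\<in>A. x $ i *\<^sub>R axis i 1) = u 0" if "finite A" for A
    using that
  proof (induction A)
    case (insert j A)
    then show ?case
      using shift[of "\<Sum>i\<in>A. x $ i *\<^sub>R axis i 1" "x $ j" j] by (simp add: add.commute)
  qed simp
  from this[of UNIV] show ?thesis
    using basis_expansion[of x] by (simp add: scalar_mult_eq_scaleR)
qed

section \<open>The space of functions with p-integrable gradient\<close>

lemma holder_continuous_imp_continuous:
  fixes u :: "real^'n \<Rightarrow> real"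
  assumes "holder_continuous \<alpha> u" "\<alpha> > 0"
  shows "continuous_on UNIV u"
proof -
  obtain C where C: "\<And>x y. \<bar>u x - u y\<bar> \<le> C * dist x y powr \<alpha>"
    using assms(1) by (auto simp: holder_continuous_def)
  have "(u \<longlongrightarrow> u x) (at x)" for x
  proof (rule LIM_zero_cancel, rule Lim_null_comparison)
    show "eventually (\<lambda>y. norm (u y - u x) \<le> C * dist y x powr \<alpha>) (at x)"
      using C by simp
    have "((\<lambda>y. dist y x) \<longlongrightarrow> dist x x) (at x)" by (intro tendsto_intros)
    then have "((\<lambda>y. dist y x powr \<alpha>) \<longlongrightarrow> 0) (at x)"
      by (intro tendsto_zero_powrI[OF _ tendsto_const]) (auto simp: assms(2))
    then show "((\<lambda>y. C * dist y x powr \<alpha>) \<longlongrightarrow> 0) (at x)"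
      by (rule tendsto_mult_right_zero)
  qed
  then show ?thesis by (simp add: continuous_on_def)
qed

lemma holder_exponent_pos:
  "real CARD('n) < p \<Longrightarrow> 1 - real CARD('n) / p > 0"
  using le_less_trans[OF of_nat_0_le_iff, of "CARD('n)" p] by (simp add: divide_less_eq_1)

lemma D1p_continuous:
  fixes u :: "real^'n \<Rightarrow> real"
  assumes "u \<in> D1p p" "real CARD('n) < p"
  shows "continuous_on UNIV u"
  using assms holder_continuous_imp_continuous holder_exponent_pos unfolding D1p_def by blast

text \<open>A crude constant, from a + b <= 2 max a b; the bound only has to provide integrable
  majorants.\<close>

lemma powr_add_le:
  fixes a b p :: real
  assumes "a \<ge> 0" "b \<ge> 0" "p > 0"
  shows "(a + b) powr p \<le> 2 powr p * (a powr p + b powr p)"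
proof -
  have "(a + b) powr p \<le> (2 * max a b) powr p"
    using assms by (intro powr_mono2) auto
  also have "\<dots> = 2 powr p * (max a b) powr p"
    by (rule powr_mult)
  also have "\<dots> \<le> 2 powr p * (a powr p + b powr p)"
    by (intro mult_left_mono) (auto simp: max_def)
  finally show ?thesis .
qed

lemma integrable_norm_add_powr:
  fixes f g :: "'a \<Rightarrow> 'b::{real_normed_vector, second_countable_topology}"
  assumes [measurable]: "f \<in> borel_measurable M" "g \<in> borel_measurable M" and p: "p > 0"
    and "integrable M (\<lambda>x. norm (f x) powr p)" "integrable M (\<lambda>x. norm (g x) powr p)"
  shows "integrable M (\<lambda>x. norm (f x + c *\<^sub>R g x) powr p)"
proof (rule Bochner_Integration.integrable_bound)
  show "integrable M (\<lambda>x. 2 powr p * (norm (f x) powr p + \<bar>c\<bar> powr p * norm (g x) powr p))"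
    using assms by auto
  show "(\<lambda>x. norm (f x + c *\<^sub>R g x) powr p) \<in> borel_measurable M" by measurable
  have "norm (f x + c *\<^sub>R g x) powr p \<le> 2 powr p * (norm (f x) powr p + \<bar>c\<bar> powr p * norm (g x) powr p)" for x
  proof -
    have "norm (f x + c *\<^sub>R g x) powr p \<le> (norm (f x) + norm (c *\<^sub>R g x)) powr p"
      using p by (intro powr_mono2 norm_triangle_ineq) auto
    also have "\<dots> \<le> 2 powr p * (norm (f x) powr p + norm (c *\<^sub>R g x) powr p)"
      using p by (intro powr_add_le) auto
    finally show ?thesis by (simp add: powr_mult)
  qed
  then show "AE x in M. norm (norm (f x + c *\<^sub>R g x) powr p)
      \<le> norm (2 powr p * (norm (f x) powr p + \<bar>c\<bar> powr p * norm (g x) powr p))"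
    by (intro AE_I2) (simp add: abs_of_nonneg add_nonneg_nonneg)
qed

text \<open>Links the componentwise Lp condition in \<open>D1p\<close> with the Euclidean norm in
  \<open>grad_norm\<close>: the norm is at most n times the largest component.\<close>

lemma norm_powr_le_sum_components:
  fixes v :: "real^'n"
  assumes "p > 0"
  shows "norm v powr p \<le> real CARD('n) powr p * (\<Sum>i\<in>UNIV. \<bar>v $ i\<bar> powr p)"
proof -
  have "Max (range (\<lambda>i. \<bar>v $ i\<bar>)) \<in> range (\<lambda>i. \<bar>v $ i\<bar>)"
    by (intro Max_in) auto
  then obtain j where "Max (range (\<lambda>i. \<bar>v $ i\<bar>)) = \<bar>v $ j\<bar>" by blast
  then have j: "\<bar>v $ i\<bar> \<le> \<bar>v $ j\<bar>" for i
    using Max_ge[of "range (\<lambda>i. \<bar>v $ i\<bar>)" "\<bar>v $ i\<bar>"] by simp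
  have "norm v \<le> (\<Sum>i\<in>UNIV. \<bar>v $ i\<bar>)" by (rule norm_le_l1_cart)
  also have "\<dots> \<le> real CARD('n) * \<bar>v $ j\<bar>" by (intro sum_bounded_above j)
  finally have "norm v powr p \<le> (real CARD('n) * \<bar>v $ j\<bar>) powr p"
    using assms by (intro powr_mono2) auto
  also have "\<dots> = real CARD('n) powr p * \<bar>v $ j\<bar> powr p"
    by (rule powr_mult)
  also have "\<dots> \<le> real CARD('n) powr p * (\<Sum>i\<in>UNIV. \<bar>v $ i\<bar> powr p)"
    by (intro mult_left_mono member_le_sum) auto
  finally show ?thesis .
qed

lemma borel_measurable_cart:
  fixes f :: "'a \<Rightarrow> real^'n"
  assumes "\<And>i. (\<lambda>x. f x $ i) \<in> borel_measurable M"
  shows "f \<in> borel_measurable M"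
  using assms by (subst borel_measurable_euclidean_space) (auto simp: Basis_vec_def inner_axis)

lemma has_weak_partial_borel_measurable:
  "(\<And>i. has_weak_partial u i (\<lambda>x. G x $ i)) \<Longrightarrow> G \<in> borel_measurable borel"
  by (intro borel_measurable_cart locally_integrable_borel_measurable) (auto simp: has_weak_partial_def)

text \<open>The route by which gradients are computed: it suffices to guess G and verify the weak
  derivative property. Existence of G also guarantees that the choice in \<open>weak_grad\<close>
  returns a genuine weak derivative.\<close>

lemma weak_grad_AE:
  fixes u :: "real^'n \<Rightarrow> real"
  assumes G: "\<And>i. has_weak_partial u i (\<lambda>x. G x $ i)"
  shows "AE x in lborel. weak_grad u x = G x"
proof -
  have "has_weak_partial u i (SOME g. has_weak_partial u i g)" for i
    using someI[of "\<lambda>g. has_weak_partial u i g", OF G] .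
  then have "AE x in lborel. \<forall>i\<in>UNIV. (SOME g. has_weak_partial u i g) x = G x $ i"
    by (intro AE_finite_allI has_weak_partial_unique[OF _ G]) auto
  then show ?thesis
    by eventually_elim (simp add: weak_grad_def vec_eq_iff)
qed

lemma has_weak_partial_weak_grad:
  fixes u :: "real^'n \<Rightarrow> real"
  assumes "u \<in> D1p p"
  shows "has_weak_partial u i (\<lambda>x. weak_grad u x $ i)"
proof -
  have "\<exists>g. has_weak_partial u i g" using assms by (auto simp: D1p_def)
  then have "has_weak_partial u i (SOME g. has_weak_partial u i g)" by (rule someI_ex)
  then show ?thesis by (simp add: weak_grad_def)
qed

lemma weak_grad_measurable:
  "u \<in> D1p p \<Longrightarrow> weak_grad u \<in> borel_measurable borel"
  using has_weak_partial_borel_measurable[OF has_weak_partial_weak_grad] .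

lemma weak_grad_powr_integrable:
  fixes u :: "real^'n \<Rightarrow> real"
  assumes u: "u \<in> D1p p" and p: "p > 0"
  shows "integrable lborel (\<lambda>x. norm (weak_grad u x) powr p)"
proof (rule Bochner_Integration.integrable_bound)
  note [measurable] = weak_grad_measurable[OF u]
  have "integrable lborel (\<lambda>x. \<bar>weak_grad u x $ i\<bar> powr p)" for i
  proof -
    obtain g where g: "has_weak_partial u i g" "in_Lp p g"
      using u by (auto simp: D1p_def)
    \<comment> \<open>Membership in \<open>D1p\<close> provides some version in Lp, not necessarily
      the chosen one; uniqueness transfers the integrability.\<close>
    have "AE x in lborel. g x = weak_grad u x $ i"
      by (rule has_weak_partial_unique[OF g(1) has_weak_partial_weak_grad[OF u]])
    then have "AE x in lborel. \<bar>g x\<bar> powr p = \<bar>weak_grad u x $ i\<bar> powr p" by eventually_elim simp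
    moreover have "(\<lambda>x. \<bar>weak_grad u x $ i\<bar> powr p) \<in> borel_measurable lborel" by measurable
    ultimately show ?thesis
      using g(2) integrable_cong_AE_imp unfolding in_Lp_def by blast
  qed
  then show "integrable lborel (\<lambda>x. real CARD('n) powr p * (\<Sum>i\<in>UNIV. \<bar>weak_grad u x $ i\<bar> powr p))"
    by auto
  show "AE x in lborel. norm (norm (weak_grad u x) powr p)
      \<le> norm (real CARD('n) powr p * (\<Sum>i\<in>UNIV. \<bar>weak_grad u x $ i\<bar> powr p))"
    using norm_powr_le_sum_components[OF p, where ?'n='n] by (intro AE_I2) (simp add: abs_of_nonneg sum_nonneg)
  show "(\<lambda>x. norm (weak_grad u x) powr p) \<in> borel_measurable lborel" by measurable
qed

lemma D1pI:
  fixes u :: "real^'n \<Rightarrow> real"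
  assumes p: "p > 0" and h: "holder_continuous (1 - real CARD('n) / p) u"
    and G: "\<And>i. has_weak_partial u i (\<lambda>x. G x $ i)"
    and int: "integrable lborel (\<lambda>x. norm (G x) powr p)"
  shows "u \<in> D1p p"
proof -
  have "in_Lp p (\<lambda>x. G x $ i)" for i
    unfolding in_Lp_def
  proof
    show m: "(\<lambda>x. G x $ i) \<in> borel_measurable lborel"
      using G[of i] by (simp add: has_weak_partial_def locally_integrable_borel_measurable)
    show "integrable lborel (\<lambda>x. \<bar>G x $ i\<bar> powr p)"
      using m p by (intro Bochner_Integration.integrable_bound[OF int])
        (auto intro!: powr_mono2 component_le_norm_cart)
  qed
  moreover have "locally_integrable u" using G by (auto simp: has_weak_partial_def)
  ultimately show ?thesis using h G by (auto simp: D1p_def)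
qed

lemma has_weak_partial_linear:
  assumes "has_weak_partial u i g" "has_weak_partial v i h"
  shows "has_weak_partial (\<lambda>x. u x + c * v x) i (\<lambda>x. g x + c * h x)"
  unfolding has_weak_partial_def
proof (intro conjI ballI)
  have li: "locally_integrable u" "locally_integrable v" "locally_integrable g" "locally_integrable h"
    using assms by (auto simp: has_weak_partial_def)
  then show "locally_integrable (\<lambda>x. u x + c * v x)" "locally_integrable (\<lambda>x. g x + c * h x)"
    by (auto intro: locally_integrable_add locally_integrable_cmult)
  fix \<phi> assume \<phi>: "\<phi> \<in> (test_functions :: (real^'a \<Rightarrow> real) set)"
  note d\<phi> = test_function_partial_deriv[OF \<phi>, of i]
  have *: "(LINT x|lborel. (a x + c * b x) * \<psi> x) = (LINT x|lborel. a x * \<psi> x) + c * (LINT x|lborel. b x * \<psi> x)"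
    if "locally_integrable a" "locally_integrable b" "\<psi> \<in> test_functions" for a b \<psi> :: "real^'a \<Rightarrow> real"
  proof -
    have i: "integrable lborel (\<lambda>x. a x * \<psi> x)" "integrable lborel (\<lambda>x. b x * \<psi> x)"
      using that by (auto intro: locally_integrable_test)
    have "(LINT x|lborel. (a x + c * b x) * \<psi> x) = (LINT x|lborel. a x * \<psi> x + c * (b x * \<psi> x))"
      by (simp add: algebra_simps)
    then show ?thesis using i by simp
  qed
  show "(LINT x|lborel. (u x + c * v x) * partial_deriv i \<phi> x) = - (LINT x|lborel. (g x + c * h x) * \<phi> x)"
    using assms \<phi> unfolding *[OF li(1,2) d\<phi>] *[OF li(3,4) \<phi>] by (simp add: has_weak_partial_def)
qed

lemma holder_continuous_linear:
  assumes "holder_continuous \<alpha> u" "holder_continuous \<alpha> v"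
  shows "holder_continuous \<alpha> (\<lambda>x. u x + c * v x)"
proof -
  obtain A B where AB: "\<And>x y. \<bar>u x - u y\<bar> \<le> A * dist x y powr \<alpha>" "\<And>x y. \<bar>v x - v y\<bar> \<le> B * dist x y powr \<alpha>"
    using assms by (auto simp: holder_continuous_def)
  have "\<bar>u x + c * v x - (u y + c * v y)\<bar> \<le> (A + \<bar>c\<bar> * B) * dist x y powr \<alpha>" for x y
  proof -
    have "u x + c * v x - (u y + c * v y) = (u x - u y) + c * (v x - v y)"
      by (simp add: algebra_simps)
    then have "\<bar>u x + c * v x - (u y + c * v y)\<bar> \<le> \<bar>u x - u y\<bar> + \<bar>c\<bar> * \<bar>v x - v y\<bar>"
      by (metis abs_mult abs_triangle_ineq)
    also have "\<dots> \<le> A * dist x y powr \<alpha> + \<bar>c\<bar> * (B * dist x y powr \<alpha>)"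
      by (intro add_mono mult_left_mono AB) auto
    finally show ?thesis by (simp add: algebra_simps)
  qed
  then show ?thesis by (auto simp: holder_continuous_def)
qed

lemma D1p_linear:
  fixes u v :: "real^'n \<Rightarrow> real"
  assumes u: "u \<in> D1p p" and v: "v \<in> D1p p" and p: "p > 0"
  shows "(\<lambda>x. u x + c * v x) \<in> D1p p"
    and weak_grad_linear: "AE x in lborel. weak_grad (\<lambda>x. u x + c * v x) x = weak_grad u x + c *\<^sub>R weak_grad v x"
proof -
  have G: "has_weak_partial (\<lambda>x. u x + c * v x) i (\<lambda>x. (weak_grad u x + c *\<^sub>R weak_grad v x) $ i)" for i
    using has_weak_partial_linear[OF has_weak_partial_weak_grad[OF u] has_weak_partial_weak_grad[OF v]] by simp
  then show "AE x in lborel. weak_grad (\<lambda>x. u x + c * v x) x = weak_grad u x + c *\<^sub>R weak_grad v x"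
    by (rule weak_grad_AE)
  show "(\<lambda>x. u x + c * v x) \<in> D1p p"
  proof (rule D1pI[OF p _ G])
    show "integrable lborel (\<lambda>x. norm (weak_grad u x + c *\<^sub>R weak_grad v x) powr p)"
      using u v p by (intro integrable_norm_add_powr weak_grad_powr_integrable) (simp_all add: weak_grad_measurable)
  qed (use u v in \<open>auto simp: D1p_def intro: holder_continuous_linear\<close>)
qed

lemma test_function_bounded:
  assumes "\<phi> \<in> test_functions"
  obtains B where "B \<ge> 0" "\<And>x. \<bar>\<phi> x\<bar> \<le> B"
proof -
  obtain K where K: "compact K" "\<And>x. x \<notin> K \<Longrightarrow> \<phi> x = 0"
    using test_function_support[OF assms] by blast
  have "bounded (\<phi> ` K)"
    using K(1) test_functions_continuous[OF assms] by (intro compact_imp_bounded compact_continuous_image)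
  then obtain B where "\<And>x. x \<in> K \<Longrightarrow> \<bar>\<phi> x\<bar> \<le> B"
    by (auto simp: bounded_iff)
  then have "\<bar>\<phi> x\<bar> \<le> \<bar>B\<bar>" for x
    using K(2)[of x] by (cases "x \<in> K") fastforce+
  then show thesis using that[of "\<bar>B\<bar>"] by simp
qed

lemma test_function_lipschitz:
  fixes \<phi> :: "real^'n \<Rightarrow> real"
  assumes \<phi>: "\<phi> \<in> test_functions"
  obtains L where "L \<ge> 0" "\<And>x y. \<bar>\<phi> x - \<phi> y\<bar> \<le> L * dist x y"
proof -
  have "\<exists>B. B \<ge> 0 \<and> (\<forall>x. \<bar>partial_deriv i \<phi> x\<bar> \<le> B)" for i
    using test_function_bounded[OF test_function_partial_deriv[OF \<phi>]] by metis
  then obtain B where B: "\<And>i. B i \<ge> 0" "\<And>i x. \<bar>partial_deriv i \<phi> x\<bar> \<le> B i" by metis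
  have "norm (\<phi> x - \<phi> y) \<le> (\<Sum>i\<in>UNIV. B i) * norm (x - y)" for x y
  proof (rule differentiable_bound[of UNIV])
    fix x :: "real^'n"
    show "(\<phi> has_derivative (\<lambda>v. \<Sum>j\<in>UNIV. v $ j * partial_deriv j \<phi> x)) (at x)"
      by (intro has_derivative_partial_deriv test_functions_differentiable \<phi>)
    show "onorm (\<lambda>v. \<Sum>j\<in>UNIV. v $ j * partial_deriv j \<phi> x) \<le> (\<Sum>i\<in>UNIV. B i)"
    proof (rule onorm_le)
      fix v :: "real^'n"
      have "norm (\<Sum>j\<in>UNIV. v $ j * partial_deriv j \<phi> x) \<le> (\<Sum>j\<in>UNIV. norm v * B j)"
        by (rule order_trans[OF norm_sum sum_mono])
          (auto simp: abs_mult intro!: mult_mono B component_le_norm_cart)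
      then show "norm (\<Sum>j\<in>UNIV. v $ j * partial_deriv j \<phi> x) \<le> (\<Sum>i\<in>UNIV. B i) * norm v"
        by (simp add: sum_distrib_left mult.commute)
    qed
  qed auto
  then show thesis
    using that[of "\<Sum>i\<in>UNIV. B i"] B(1) by (simp add: sum_nonneg dist_norm)
qed

text \<open>Up to distance 1 the Lipschitz bound suffices, since there t <= t powr
  \<open>\<alpha>\<close>; beyond it the oscillation is at most 2 B while the power is at least
  1.\<close>

lemma test_function_holder_continuous:
  fixes \<phi> :: "real^'n \<Rightarrow> real"
  assumes \<phi>: "\<phi> \<in> test_functions" and \<alpha>: "0 < \<alpha>" "\<alpha> \<le> 1"
  shows "holder_continuous \<alpha> \<phi>"
proof -
  obtain B where B: "B \<ge> 0" "\<And>x. \<bar>\<phi> x\<bar> \<le> B" using test_function_bounded[OF \<phi>] by blast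
  obtain L where L: "L \<ge> 0" "\<And>x y. \<bar>\<phi> x - \<phi> y\<bar> \<le> L * dist x y" using test_function_lipschitz[OF \<phi>] by blast
  have "\<bar>\<phi> x - \<phi> y\<bar> \<le> (L + 2 * B) * dist x y powr \<alpha>" for x y
  proof (cases "dist x y \<le> 1")
    case True
    have "\<bar>\<phi> x - \<phi> y\<bar> \<le> L * dist x y" by (rule L)
    also have "\<dots> \<le> L * dist x y powr \<alpha>"
      using True \<alpha> powr_mono'[of \<alpha> 1 "dist x y"] by (intro mult_left_mono L(1)) simp
    also have "\<dots> \<le> (L + 2 * B) * dist x y powr \<alpha>"
      using B by (intro mult_right_mono) auto
    finally show ?thesis .
  next
    case False
    have "\<bar>\<phi> x - \<phi> y\<bar> \<le> (2 * B) * 1" using B(2)[of x] B(2)[of y] by linarith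
    also have "\<dots> \<le> (L + 2 * B) * dist x y powr \<alpha>"
      using False \<alpha> B L(1) by (intro mult_mono ge_one_powr_ge_zero) auto
    finally show ?thesis .
  qed
  then show ?thesis by (auto simp: holder_continuous_def)
qed

lemma test_function_D1p:
  fixes \<phi> :: "real^'n \<Rightarrow> real"
  assumes \<phi>: "\<phi> \<in> test_functions" and p: "real CARD('n) < p"
  shows "\<phi> \<in> D1p p"
proof (rule D1pI)
  have p0: "p > 0" using p by linarith
  show "p > 0" by fact
  show "holder_continuous (1 - real CARD('n) / p) \<phi>"
    using p0 by (intro test_function_holder_continuous \<phi> holder_exponent_pos p) simp
  define G where "G x = (\<chi> i. partial_deriv i \<phi> x)" for x
  show "has_weak_partial \<phi> i (\<lambda>x. G x $ i)" for i
    using test_function_has_weak_partial[OF \<phi>] by (simp add: G_def)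
  have Gc: "continuous_on UNIV G"
    unfolding G_def by (intro continuous_on_vec_lambda test_functions_continuous test_function_partial_deriv \<phi>)
  have "\<exists>K. compact K \<and> (\<forall>x. x \<notin> K \<longrightarrow> partial_deriv i \<phi> x = 0)" for i
    using test_function_support[OF test_function_partial_deriv[OF \<phi>]] by metis
  then obtain K where K: "\<And>i. compact (K i)" "\<And>i x. x \<notin> K i \<Longrightarrow> partial_deriv i \<phi> x = 0" by metis
  have "integrable lborel (\<lambda>x. 1 * norm (G x) powr p)"
  proof (rule locally_integrable_mult)
    show "locally_integrable (\<lambda>x::real^'n. 1 :: real)"
      by (intro continuous_imp_locally_integrable continuous_intros)
    show "continuous_on UNIV (\<lambda>x. norm (G x) powr p)"
      using p0 by (intro continuous_on_powr' continuous_intros Gc) auto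
    show "compact (\<Union>i. K i)" using K by (intro compact_UN) auto
    show "norm (G x) powr p = 0" if "x \<notin> (\<Union>i. K i)" for x
      using that K(2) by (auto simp: G_def zero_vec_def)
  qed
  then show "integrable lborel (\<lambda>x. norm (G x) powr p)" by simp
qed

section \<open>Similarities and weak gradients\<close>

lemma nn_integral_lborel_translate:
  fixes f :: "'a::euclidean_space \<Rightarrow> ennreal"
  assumes [measurable]: "f \<in> borel_measurable borel"
  shows "(\<integral>\<^sup>+x. f (z + x) \<partial>lborel) = (\<integral>\<^sup>+x. f x \<partial>lborel)"
proof -
  have "(\<integral>\<^sup>+x. f x \<partial>lborel) = (\<integral>\<^sup>+x. f x \<partial>distr lborel borel ((+) z))"
    by (simp add: lborel_distr_plus)
  then show ?thesis by (simp add: nn_integral_distr)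
qed

text \<open>Uniqueness of Haar measure by Fubini, normalised on the unit ball, which is preserved by
  orthogonal maps. (The library's change of variables needs a well-ordered index type.)\<close>
lemma lborel_distr_orthogonal:
  fixes R :: "'a::euclidean_space \<Rightarrow> 'a"
  assumes R: "orthogonal_transformation R"
  shows "distr lborel borel R = lborel"
proof (rule measure_eqI)
  have lin: "linear R" using R by (simp add: orthogonal_transformation_linear)
  have [measurable]: "R \<in> borel_measurable borel"
    using lin by (intro borel_measurable_continuous_onI linear_continuous_on) (simp add: linear_linear)
  define B where "B = ball (0::'a) 1"
  have B [measurable]: "B \<in> sets borel" by (simp add: B_def)
  have B_R: "R x \<in> B \<longleftrightarrow> x \<in> B" and B_minus: "- x \<in> B \<longleftrightarrow> x \<in> B" for x
    using orthogonal_transformation_norm[OF R] by (auto simp: B_def)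
  have B_pos: "emeasure lborel B > 0" "emeasure lborel B < \<infinity>"
    by (auto simp: B_def emeasure_lborel_ball_finite emeasure_ball unit_ball_vol_pos)
  fix A assume "A \<in> sets (distr lborel borel R)"
  then have A [measurable]: "A \<in> sets borel" by simp
  have "emeasure lborel B * emeasure lborel A
      = (\<integral>\<^sup>+x. indicator B (R x) * (\<integral>\<^sup>+y. indicator A y \<partial>lborel) \<partial>lborel)"
    by (simp add: nn_integral_multc indicator_def B_R)
      (simp add: indicator_def[symmetric] nn_integral_indicator[unfolded indicator_def of_bool_def[symmetric]])
  also have "\<dots> = (\<integral>\<^sup>+x. \<integral>\<^sup>+y. indicator B (R x) * indicator A (R x + y) \<partial>lborel \<partial>lborel)"
    by (simp add: nn_integral_cmult nn_integral_lborel_translate del: nn_integral_indicator)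
  also have "\<dots> = (\<integral>\<^sup>+y. \<integral>\<^sup>+x. indicator B (R x) * indicator A (R x + y) \<partial>lborel \<partial>lborel)"
    by (rule lborel_pair.Fubini') measurable
  also have "\<dots> = (\<integral>\<^sup>+y. \<integral>\<^sup>+x. indicator B (R x - y) * indicator A (R x) \<partial>lborel \<partial>lborel)"
  proof (rule nn_integral_cong)
    fix y
    \<comment> \<open>Shifting x by this z replaces R x by R x - y, so y leaves the argument of A
      and enters that of B. After the next exchange of integrals the inner one no longer involves
      A.\<close>
    obtain z where z: "R z = - y"
      using orthogonal_transformation_surj[OF R] by (metis surjD)
    show "(\<integral>\<^sup>+x. indicator B (R x) * indicator A (R x + y) \<partial>lborel)
        = (\<integral>\<^sup>+x. indicator B (R x - y) * indicator A (R x) \<partial>lborel)"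
      using nn_integral_lborel_translate[of "\<lambda>x. indicator B (R x) * indicator A (R x + y)" z]
      by (simp add: linear_add[OF lin] z)
  qed
  also have "\<dots> = (\<integral>\<^sup>+x. \<integral>\<^sup>+y. indicator B (R x - y) * indicator A (R x) \<partial>lborel \<partial>lborel)"
    by (rule lborel_pair.Fubini') measurable
  also have "\<dots> = (\<integral>\<^sup>+x. emeasure lborel B * indicator A (R x) \<partial>lborel)"
  proof (rule nn_integral_cong)
    fix x
    have "indicator B (R x - y) = (indicator B (- R x + y) :: ennreal)" for y
      using B_minus[of "R x - y"] by (simp add: indicator_def)
    then show "(\<integral>\<^sup>+y. indicator B (R x - y) * indicator A (R x) \<partial>lborel)
        = emeasure lborel B * indicator A (R x)"
      using nn_integral_lborel_translate[of "indicator B" "- R x"]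
      by (simp add: nn_integral_multc)
  qed
  also have "\<dots> = emeasure lborel B * (\<integral>\<^sup>+x. indicator A x \<partial>distr lborel borel R)"
    by (simp add: nn_integral_cmult nn_integral_distr del: nn_integral_indicator)
  also have "(\<integral>\<^sup>+x. indicator A x \<partial>distr lborel borel R) = emeasure (distr lborel borel R) A"
    by (simp add: nn_integral_indicator)
  finally show "emeasure (distr lborel borel R) A = emeasure lborel A"
    using B_pos by (auto simp: ennreal_mult_cancel_left)
qed simp

lemma lborel_distr_similarity:
  fixes R :: "real^'n \<Rightarrow> real^'n"
  assumes r: "r > 0" and R: "orthogonal_transformation R" and T: "T = (\<lambda>y. r *\<^sub>R R y + z)"
  shows "distr lborel borel T = density lborel (\<lambda>_. ennreal (1 / r ^ CARD('n)))"
proof -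
  have [measurable]: "R \<in> borel_measurable borel"
    using R by (intro borel_measurable_continuous_onI linear_continuous_on)
      (simp add: linear_linear orthogonal_transformation_linear)
  define D where "D = distr lborel borel (\<lambda>x::real^'n. z + r *\<^sub>R x)"
  have "T = (\<lambda>x. z + r *\<^sub>R x) \<circ> R" by (auto simp: T fun_eq_iff)
  then have "distr lborel borel T = distr (distr lborel borel R) borel (\<lambda>x. z + r *\<^sub>R x)"
    by (simp add: distr_distr)
  also have "\<dots> = D" unfolding lborel_distr_orthogonal[OF R] D_def ..
  \<comment> \<open>\<open>lborel_affine\<close> presents Lebesgue measure as r^n times D. Inserting
    the factor r^n and its reciprocal solves this for D.\<close>
  also have "D = density (density D (\<lambda>_. ennreal (r ^ CARD('n)))) (\<lambda>_. ennreal (1 / r ^ CARD('n)))"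
    using r by (subst density_density_eq) (auto simp: ennreal_mult[symmetric] density_1)
  also have "density D (\<lambda>_. ennreal (r ^ CARD('n))) = lborel"
    using lborel_affine[of r z] r by (simp add: D_def)
  finally show ?thesis .
qed

lemma integral_similarity:
  fixes f :: "real^'n \<Rightarrow> real" and R :: "real^'n \<Rightarrow> real^'n"
  assumes f [measurable]: "f \<in> borel_measurable borel"
    and r: "r > 0" and R: "orthogonal_transformation R" and T: "T = (\<lambda>y. r *\<^sub>R R y + z)"
  shows "(LINT x|lborel. f (T x)) = (LINT x|lborel. f x) / r ^ CARD('n)"
proof -
  have [measurable]: "T \<in> borel_measurable borel"
    using r R T by (intro borel_measurable_similarity) (auto simp: similarities_def)
  have "(LINT x|lborel. f (T x)) = (LINT x|distr lborel borel T. f x)"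
    by (simp add: integral_distr)
  also have "\<dots> = (LINT x|lborel. f x) / r ^ CARD('n)"
    unfolding lborel_distr_similarity[OF r R T] using r by (subst integral_density) auto
  finally show ?thesis .
qed

lemma integrable_similarity:
  fixes f :: "real^'n \<Rightarrow> real"
  assumes f: "integrable lborel f" and T: "T \<in> similarities"
  shows "integrable lborel (\<lambda>x. f (T x))"
proof -
  obtain r R z where *: "r > 0" "orthogonal_transformation R" "T = (\<lambda>y. r *\<^sub>R R y + z)"
    using similarityE[OF T] by blast
  have [measurable]: "T \<in> borel_measurable borel" by (rule borel_measurable_similarity[OF T])
  have "integrable (distr lborel borel T) f"
    unfolding lborel_distr_similarity[OF *] using f *(1) by (subst integrable_density) auto
  then show ?thesis by (rule integrable_distr[rotated]) simp
qed

lemma locally_integrable_similarity: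
  fixes f :: "real^'n \<Rightarrow> real"
  assumes f: "locally_integrable f" and T: "T \<in> similarities"
  shows "locally_integrable (\<lambda>x. f (T x))"
  unfolding locally_integrable_def
proof (intro allI impI)
  obtain T' where T': "T' \<in> similarities" "\<And>x. T (T' x) = x" "\<And>x. T' (T x) = x"
    using similarity_inverse[OF T] by blast
  fix K :: "(real^'n) set" assume "compact K"
  then have "compact (T ` K)" by (intro compact_continuous_image continuous_on_similarity T)
  then have "integrable lborel (\<lambda>x. indicator (T ` K) x *\<^sub>R f x)"
    using f by (auto simp: locally_integrable_def set_integrable_def)
  from integrable_similarity[OF this T]
  have "integrable lborel (\<lambda>x. indicator (T ` K) (T x) *\<^sub>R f (T x))" .
  moreover have "indicator (T ` K) (T x) = (indicator K x :: real)" for x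
    using T'(3) by (auto simp: indicator_def image_iff) metis
  ultimately show "set_integrable lborel K (\<lambda>x. f (T x))"
    by (simp add: set_integrable_def)
qed

lemma test_function_similarity:
  fixes \<phi> :: "real^'n \<Rightarrow> real"
  assumes \<phi>: "\<phi> \<in> test_functions" and T: "T \<in> similarities"
  shows "(\<lambda>x. \<phi> (T x)) \<in> test_functions"
proof -
  obtain r R z where *: "r > 0" "orthogonal_transformation R" and Teq: "T = (\<lambda>y. r *\<^sub>R R y + z)"
    using similarityE[OF T] by blast
  obtain T' where T': "T' \<in> similarities" "\<And>x. T (T' x) = x" "\<And>x. T' (T x) = x"
    using similarity_inverse[OF T] by blast
  obtain K where K: "compact K" "\<And>x. x \<notin> K \<Longrightarrow> \<phi> x = 0"
    using test_function_support[OF \<phi>] by blast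
  have lin: "linear (\<lambda>y. r *\<^sub>R R y)"
    using *(2) by (intro linear_compose_scale_right orthogonal_transformation_linear)
  show ?thesis
  proof (rule test_functionI)
    show "C_k k (\<lambda>x. \<phi> (T x))" for k
      unfolding Teq by (rule C_k_affine[OF test_function_C_k[OF \<phi>] lin])
    show "compact (T' ` K)"
      by (intro compact_continuous_image continuous_on_similarity T' K)
    show "\<phi> (T x) = 0" if "x \<notin> T' ` K" for x
      using that K(2)[of "T x"] T'(3)[of x] by (metis image_eqI)
  qed
qed

text \<open>The gradient of a composite is the transposed derivative of T applied to the gradient,
  and the transpose of an orthogonal map is its inverse. The derivative cannot be taken on u, so
  \<open>\<phi>\<close> is written as \<open>\<psi>\<close> after T: the classical chain rule
  applies to \<open>\<psi>\<close>, and the Jacobian factors of the two changes of variables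
  cancel.\<close>

lemma has_weak_partial_similarity:
  fixes u :: "real^'n \<Rightarrow> real" and R :: "real^'n \<Rightarrow> real^'n"
  assumes G: "\<And>i. has_weak_partial u i (\<lambda>x. G x $ i)"
    and r: "r > 0" and R: "orthogonal_transformation R" and T: "T = (\<lambda>y. r *\<^sub>R R y + z)"
  shows "has_weak_partial (\<lambda>x. u (T x)) i (\<lambda>x. (r *\<^sub>R inv R (G (T x))) $ i)"
proof -
  have Ts: "T \<in> similarities" using r R T by (auto simp: similarities_def)
  obtain T' where T': "T' \<in> similarities" "\<And>x. T (T' x) = x" "\<And>x. T' (T x) = x"
    using similarity_inverse[OF Ts] by blast
  have lin: "linear (\<lambda>y. r *\<^sub>R R y)"
    using R by (intro linear_compose_scale_right orthogonal_transformation_linear)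
  \<comment> \<open>Column i of the matrix of r R, that is, row i of its transpose.\<close>
  define c where "c j = r * R (axis i 1) $ j" for j
  have inv_R: "(r *\<^sub>R inv R v) $ i = (\<Sum>j\<in>UNIV. c j * v $ j)" for v
  proof -
    have "inv R v $ i = inv R v \<bullet> axis i 1" by (simp add: inner_axis)
    also have "\<dots> = R (inv R v) \<bullet> R (axis i 1)"
      using R by (simp add: orthogonal_transformation_def)
    also have "R (inv R v) = v"
      using orthogonal_transformation_surj[OF R] by (rule surj_f_inv_f)
    also have "v \<bullet> R (axis i 1) = (\<Sum>j\<in>UNIV. v $ j * R (axis i 1) $ j)"
      by (simp add: inner_vec_def)
    finally show ?thesis by (simp add: c_def sum_distrib_left mult_ac)
  qed
  have li: "locally_integrable u" "locally_integrable (\<lambda>x. G x $ j)" for j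
    using G by (auto simp: has_weak_partial_def)
  have liG: "locally_integrable (\<lambda>x. \<Sum>j\<in>UNIV. c j * G x $ j)"
  proof -
    have "locally_integrable (\<lambda>x. \<Sum>j\<in>J. c j * G x $ j)" if "finite J" for J
      using that
    proof induction
      case empty
      show ?case by (auto intro: continuous_imp_locally_integrable)
    next
      case (insert j J)
      then show ?case by (simp add: locally_integrable_add locally_integrable_cmult li)
    qed
    then show ?thesis by simp
  qed
  show ?thesis
    unfolding has_weak_partial_def inv_R
  proof (intro conjI ballI)
    show "locally_integrable (\<lambda>x. u (T x))" by (rule locally_integrable_similarity[OF li(1) Ts])
    show "locally_integrable (\<lambda>x. \<Sum>j\<in>UNIV. c j * G (T x) $ j)"
      by (rule locally_integrable_similarity[OF liG Ts])
    fix \<phi> :: "real^'n \<Rightarrow> real" assume \<phi>: "\<phi> \<in> test_functions"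
    define \<psi> where "\<psi> y = \<phi> (T' y)" for y
    have \<psi>: "\<psi> \<in> test_functions" unfolding \<psi>_def by (rule test_function_similarity[OF \<phi> T'(1)])
    have \<phi>\<psi>: "\<phi> = (\<lambda>x. \<psi> (r *\<^sub>R R x + z))" using T'(3) T by (simp add: \<psi>_def fun_eq_iff)
    note d\<psi> = test_function_partial_deriv[OF \<psi>]
    have [measurable]: "\<psi> \<in> borel_measurable borel" "partial_deriv j \<psi> \<in> borel_measurable borel"
      "u \<in> borel_measurable borel" "(\<lambda>x. G x $ j) \<in> borel_measurable borel" for j
      using \<psi> d\<psi> li by (auto intro: borel_measurable_continuous_onI test_functions_continuous
          locally_integrable_borel_measurable)
    have "partial_deriv i \<phi> x = (\<Sum>j\<in>UNIV. c j * partial_deriv j \<psi> (T x))" for x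
      unfolding \<phi>\<psi> using partial_deriv_affine[OF test_functions_differentiable[OF \<psi>] lin]
      by (simp add: c_def T)
    then have "(LINT x|lborel. u (T x) * partial_deriv i \<phi> x)
        = (LINT x|lborel. u (T x) * (\<Sum>j\<in>UNIV. c j * partial_deriv j \<psi> (T x)))" by simp
    also have "\<dots> = (LINT x|lborel. u x * (\<Sum>j\<in>UNIV. c j * partial_deriv j \<psi> x)) / r ^ CARD('n)"
      by (rule integral_similarity[OF _ r R T]) measurable
    also have "(LINT x|lborel. u x * (\<Sum>j\<in>UNIV. c j * partial_deriv j \<psi> x))
        = (LINT x|lborel. (\<Sum>j\<in>UNIV. c j * (u x * partial_deriv j \<psi> x)))"
      by (simp add: sum_distrib_left mult_ac)
    also have "\<dots> = (\<Sum>j\<in>UNIV. c j * (LINT x|lborel. u x * partial_deriv j \<psi> x))"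
      using locally_integrable_test[OF li(1) d\<psi>] by (subst Bochner_Integration.integral_sum) auto
    also have "\<dots> = - (\<Sum>j\<in>UNIV. c j * (LINT x|lborel. G x $ j * \<psi> x))"
      using G \<psi> by (simp add: has_weak_partial_def sum_negf)
    also have "(\<Sum>j\<in>UNIV. c j * (LINT x|lborel. G x $ j * \<psi> x))
        = (LINT x|lborel. (\<Sum>j\<in>UNIV. c j * (G x $ j * \<psi> x)))"
      using locally_integrable_test[OF li(2) \<psi>] by (subst Bochner_Integration.integral_sum) auto
    also have "\<dots> = (LINT x|lborel. (\<Sum>j\<in>UNIV. c j * G x $ j) * \<psi> x)"
      by (simp add: sum_distrib_right mult.assoc)
    also have "- \<dots> / r ^ CARD('n) = - (LINT x|lborel. (\<Sum>j\<in>UNIV. c j * G (T x) $ j) * \<psi> (T x))"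
      by (subst integral_similarity[OF _ r R T, of "\<lambda>x. (\<Sum>j\<in>UNIV. c j * G x $ j) * \<psi> x"]) auto
    finally show "(LINT x|lborel. u (T x) * partial_deriv i \<phi> x)
        = - (LINT x|lborel. (\<Sum>j\<in>UNIV. c j * G (T x) $ j) * \<phi> x)"
      by (simp add: \<psi>_def T'(3))
  qed
qed

text \<open>The p-th power of \<open>grad_norm\<close>. Without the root it is a plain integral, to
  which the pointwise inequalities can be applied.\<close>

definition dirichlet_energy :: "real \<Rightarrow> (real^'n \<Rightarrow> real) \<Rightarrow> real" where
  "dirichlet_energy p u = (LINT x|lborel. norm (weak_grad u x) powr p)"

lemma grad_norm_eq: "grad_norm p u = dirichlet_energy p u powr (1 / p)"
  by (simp add: grad_norm_def dirichlet_energy_def)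

lemma dirichlet_energy_nonneg: "dirichlet_energy p u \<ge> 0"
  by (simp add: dirichlet_energy_def)

lemma dirichlet_energy_cong:
  fixes u :: "real^'n \<Rightarrow> real"
  assumes "u \<in> D1p p" "AE x in lborel. weak_grad u x = G x" "G \<in> borel_measurable borel"
  shows "dirichlet_energy p u = (LINT x|lborel. norm (G x) powr p)"
proof -
  have [measurable]: "weak_grad u \<in> borel_measurable borel" "G \<in> borel_measurable borel"
    using assms weak_grad_measurable by auto
  have "AE x in lborel. norm (weak_grad u x) powr p = norm (G x) powr p"
    using assms(2) by eventually_elim simp
  then show ?thesis unfolding dirichlet_energy_def
    by (intro integral_cong_AE) auto
qed

text \<open>The p-th power of the gradient gains r^p and the change of variables r^(-n); the p-th
  root turns r^(p - n) into the power 1 - n/p. The Hoelder constant gains the same power of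
  r.\<close>

lemma D1p_similarity:
  fixes u :: "real^'n \<Rightarrow> real" and R :: "real^'n \<Rightarrow> real^'n"
  assumes u: "u \<in> D1p p" and p: "real CARD('n) < p"
    and r: "r > 0" and R: "orthogonal_transformation R" and T: "T = (\<lambda>y. r *\<^sub>R R y + z)"
  shows "(\<lambda>x. u (T x)) \<in> D1p p"
    and grad_norm_similarity: "grad_norm p (\<lambda>x. u (T x)) = r powr (1 - real CARD('n) / p) * grad_norm p u"
proof -
  have p0: "p > 0" using p by linarith
  have Ts: "T \<in> similarities" using r R T by (auto simp: similarities_def)
  define G where "G x = r *\<^sub>R inv R (weak_grad u (T x))" for x
  have G: "has_weak_partial (\<lambda>x. u (T x)) i (\<lambda>x. G x $ i)" for i
    unfolding G_def by (rule has_weak_partial_similarity[OF has_weak_partial_weak_grad[OF u] r R T])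
  have nG: "norm (G x) powr p = r powr p * norm (weak_grad u (T x)) powr p" for x
    using orthogonal_transformation_norm[OF orthogonal_transformation_inv[OF R]] r
    by (simp add: G_def powr_mult)
  have int: "integrable lborel (\<lambda>x. norm (weak_grad u x) powr p)"
    by (rule weak_grad_powr_integrable[OF u p0])
  show D: "(\<lambda>x. u (T x)) \<in> D1p p"
  proof (rule D1pI[OF p0 _ G])
    show "integrable lborel (\<lambda>x. norm (G x) powr p)"
      unfolding nG using integrable_similarity[OF int Ts] by simp
    obtain C where C: "\<And>x y. \<bar>u x - u y\<bar> \<le> C * dist x y powr (1 - real CARD('n) / p)"
      using u by (auto simp: D1p_def holder_continuous_def)
    have "dist (T x) (T y) = r * dist x y" for x y
    proof -
      have "T x - T y = r *\<^sub>R R (x - y)"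
        using linear_diff[OF orthogonal_transformation_linear[OF R]] by (simp add: T scaleR_diff_right)
      then show ?thesis using r orthogonal_transformation_norm[OF R] by (simp add: dist_norm)
    qed
    then have "\<bar>u (T x) - u (T y)\<bar> \<le> (C * r powr (1 - real CARD('n) / p)) * dist x y powr (1 - real CARD('n) / p)" for x y
      using C[of "T x" "T y"] by (simp add: powr_mult mult.assoc)
    then show "holder_continuous (1 - real CARD('n) / p) (\<lambda>x. u (T x))"
      by (auto simp: holder_continuous_def)
  qed
  have "dirichlet_energy p (\<lambda>x. u (T x)) = (LINT x|lborel. norm (G x) powr p)"
    by (rule dirichlet_energy_cong[OF D weak_grad_AE[OF G] has_weak_partial_borel_measurable[OF G]])
  also have "\<dots> = r powr p * (dirichlet_energy p u / r ^ CARD('n))"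
    unfolding nG dirichlet_energy_def
    using integral_similarity[OF _ r R T, of "\<lambda>x. norm (weak_grad u x) powr p"] borel_measurable_integrable[OF int]
    by simp
  also have "\<dots> = r powr (p - real CARD('n)) * dirichlet_energy p u"
    using r by (simp add: powr_diff powr_realpow)
  finally show "grad_norm p (\<lambda>x. u (T x)) = r powr (1 - real CARD('n) / p) * grad_norm p u"
    using p0 by (simp add: grad_norm_eq powr_mult powr_powr diff_divide_distrib)
qed

lemma D1p_const:
  assumes "p > 0"
  shows "(\<lambda>x::real^'n. c) \<in> D1p p" and weak_grad_const: "AE x in lborel. weak_grad (\<lambda>x::real^'n. c) x = 0"
proof -
  have G: "has_weak_partial (\<lambda>x::real^'n. c) i (\<lambda>x. 0 $ i)" for i
    unfolding has_weak_partial_def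
    using integral_partial_deriv_test_function
    by (auto intro!: continuous_imp_locally_integrable)
  then show "AE x in lborel. weak_grad (\<lambda>x::real^'n. c) x = 0"
    by (rule weak_grad_AE)
  show "(\<lambda>x::real^'n. c) \<in> D1p p"
    using assms by (intro D1pI[OF _ _ G]) (auto simp: holder_continuous_def intro!: exI[of _ 0])
qed

lemma D1p_cmult:
  fixes u :: "real^'n \<Rightarrow> real"
  assumes u: "u \<in> D1p p" and p: "p > 0"
  shows "(\<lambda>x. c * u x) \<in> D1p p" and grad_norm_cmult: "grad_norm p (\<lambda>x. c * u x) = \<bar>c\<bar> * grad_norm p u"
proof -
  show D: "(\<lambda>x. c * u x) \<in> D1p p"
    using D1p_linear(1)[OF D1p_const(1)[OF p, of 0] u p, of c] by simp
  have "AE x in lborel. weak_grad (\<lambda>x. c * u x) x = c *\<^sub>R weak_grad u x"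
    using weak_grad_linear[OF D1p_const(1)[OF p, of 0] u p, of c] weak_grad_const[OF p, of 0]
    by eventually_elim simp
  then have "dirichlet_energy p (\<lambda>x. c * u x) = (LINT x|lborel. norm (c *\<^sub>R weak_grad u x) powr p)"
    using weak_grad_measurable[OF u] by (intro dirichlet_energy_cong D) auto
  also have "\<dots> = \<bar>c\<bar> powr p * dirichlet_energy p u"
    by (simp add: dirichlet_energy_def powr_mult)
  finally show "grad_norm p (\<lambda>x. c * u x) = \<bar>c\<bar> * grad_norm p u"
    using p by (simp add: grad_norm_eq powr_mult powr_powr)
qed

lemma grad_norm_eq_0_imp_const:
  fixes u :: "real^'n \<Rightarrow> real"
  assumes u: "u \<in> D1p p" and p: "real CARD('n) < p" and 0: "grad_norm p u = 0"
  shows "u = (\<lambda>x. u 0)"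
proof -
  have p0: "p > 0" using p by linarith
  have "dirichlet_energy p u = 0" using 0 by (simp add: grad_norm_eq)
  then have "AE x in lborel. norm (weak_grad u x) powr p = 0"
    unfolding dirichlet_energy_def
    by (subst (asm) integral_nonneg_eq_0_iff_AE) (auto intro: weak_grad_powr_integrable[OF u p0])
  then have ae: "AE x in lborel. weak_grad u x = 0" by eventually_elim simp
  have "has_weak_partial u i (\<lambda>x. 0)" for i
    unfolding has_weak_partial_def
  proof (intro conjI ballI)
    show "locally_integrable u" using u by (simp add: D1p_def)
    show "locally_integrable (\<lambda>x::real^'n. 0::real)"
      by (intro continuous_imp_locally_integrable continuous_intros)
    fix \<phi> :: "real^'n \<Rightarrow> real" assume \<phi>: "\<phi> \<in> test_functions"
    have "(LINT x|lborel. u x * partial_deriv i \<phi> x) = - (LINT x|lborel. weak_grad u x $ i * \<phi> x)"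
      using has_weak_partial_weak_grad[OF u, of i] \<phi> by (simp add: has_weak_partial_def)
    also have "(LINT x|lborel. weak_grad u x $ i * \<phi> x) = 0"
      by (rule integral_eq_zero_AE) (use ae in \<open>eventually_elim, simp\<close>)
    also have "0 = (LINT x|lborel. 0 * \<phi> x)" by simp
    finally show "(LINT x|lborel. u x * partial_deriv i \<phi> x) = - (LINT x|lborel. 0 * \<phi> x)" .
  qed
  then show ?thesis
    using zero_weak_partials_imp_const[OF D1p_continuous[OF u p]] by blast
qed

section \<open>The p-Laplace form\<close>

text \<open>For p > 1 this is the gradient of |a|^p / p, the map V of the overview.\<close>

definition p_field :: "real \<Rightarrow> real^'n \<Rightarrow> real^'n" where
  "p_field p a = norm a powr (p - 2) *\<^sub>R a"

lemma p_field_inner_self: "p_field p a \<bullet> a = norm a powr p"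
proof (cases "a = 0")
  case False
  then have "norm a powr (p - 2) * (norm a)\<^sup>2 = norm a powr (p - 2) * norm a powr 2"
    by (simp add: powr_numeral)
  also have "\<dots> = norm a powr p" using powr_add[of "norm a" "p - 2" 2] by simp
  finally show ?thesis by (simp add: p_field_def dot_square_norm)
qed (simp add: p_field_def)

lemma norm_p_field: "norm (p_field p a) = norm a powr (p - 1)"
proof (cases "a = 0")
  case False
  then have "norm a powr (p - 2) * norm a = norm a powr (p - 2) * norm a powr 1" by simp
  also have "\<dots> = norm a powr (p - 1)" using powr_add[of "norm a" "p - 2" 1] by (simp del: powr_one powr_one')
  finally show ?thesis by (simp add: p_field_def)
qed (simp add: p_field_def)

text \<open>Cauchy-Schwarz with |V(a)| = |a|^(p-1), then Young's inequality for p and its conjugate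
  exponent q. For a = b it is an equality, which is what makes the comparison of energies
  sharp.\<close>

lemma p_field_young:
  assumes "p > 1"
  shows "p * \<bar>p_field p a \<bullet> b\<bar> \<le> (p - 1) * norm a powr p + norm b powr p"
proof -
  define q where "q = p / (p - 1)"
  have q: "q > 1" "1 / p + 1 / q = 1" and pq: "p / q = p - 1" "(p - 1) * q = p"
    using assms by (auto simp: q_def field_simps)
  have "\<bar>p_field p a \<bullet> b\<bar> \<le> norm b * norm a powr (p - 1)"
    using Cauchy_Schwarz_ineq2[of "p_field p a" b] by (simp add: norm_p_field mult.commute)
  also have "\<dots> \<le> norm b powr p / p + (norm a powr (p - 1)) powr q / q"
    using assms q by (intro Youngs_inequality) auto
  also have "(norm a powr (p - 1)) powr q = norm a powr p"
    by (simp add: powr_powr pq)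
  finally have "p * \<bar>p_field p a \<bullet> b\<bar> \<le> p * (norm b powr p / p + norm a powr p / q)"
    using assms by (intro mult_left_mono) auto
  also have "\<dots> = norm b powr p + p / q * norm a powr p"
    using assms by (simp add: algebra_simps)
  finally show ?thesis by (simp add: pq)
qed

text \<open>Near 0 the factor |a|^(p-2) may blow up when p < 2, so limits cannot be taken factor by
  factor. There the norm |a|^(p-1) of the whole field, with positive exponent, is used
  instead.\<close>

lemma p_field_tendsto:
  fixes a :: "'b \<Rightarrow> real^'n"
  assumes p: "p > 1" and a: "(a \<longlongrightarrow> l) F"
  shows "((\<lambda>k. p_field p (a k)) \<longlongrightarrow> p_field p l) F"
proof (cases "l = 0")
  case True
  have "((\<lambda>k. norm (a k) powr (p - 1)) \<longlongrightarrow> 0) F"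
    using p tendsto_norm[OF a] True
    by (intro tendsto_zero_powrI[OF _ tendsto_const]) auto
  then have "((\<lambda>k. norm (p_field p (a k))) \<longlongrightarrow> 0) F" by (simp add: norm_p_field)
  then have "((\<lambda>k. p_field p (a k)) \<longlongrightarrow> 0) F" by (rule tendsto_norm_zero_cancel)
  moreover have "p_field p l = 0" using True by (simp add: p_field_def)
  ultimately show ?thesis by simp
next
  case False
  then show ?thesis unfolding p_field_def using a by (intro tendsto_intros) auto
qed

lemma p_field_borel_measurable [measurable]: "p_field p \<in> borel_measurable borel"
  unfolding p_field_def by measurable

definition p_form :: "real \<Rightarrow> (real^'n \<Rightarrow> real) \<Rightarrow> (real^'n \<Rightarrow> real) \<Rightarrow> real" where
  "p_form p u v = (LINT x|lborel. p_field p (weak_grad u x) \<bullet> weak_grad v x)"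

lemma p_laplace_eq_iff: "p_laplace_eq p u c \<mu> \<longleftrightarrow> (\<forall>v\<in>D1p p. p_form p u v = c * signed_integral \<mu> v)"
  by (simp add: p_laplace_eq_def p_form_def p_field_def)

lemma p_form_integrable:
  fixes u v :: "real^'n \<Rightarrow> real"
  assumes u: "u \<in> D1p p" and v: "v \<in> D1p p" and p: "p > 1"
  shows "integrable lborel (\<lambda>x. p_field p (weak_grad u x) \<bullet> weak_grad v x)"
proof (rule Bochner_Integration.integrable_bound)
  note [measurable] = weak_grad_measurable[OF u] weak_grad_measurable[OF v]
  show "integrable lborel (\<lambda>x. ((p - 1) * norm (weak_grad u x) powr p + norm (weak_grad v x) powr p) / p)"
    using weak_grad_powr_integrable[OF u] weak_grad_powr_integrable[OF v] p by simp
  show "(\<lambda>x. p_field p (weak_grad u x) \<bullet> weak_grad v x) \<in> borel_measurable lborel" by measurable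
  show "AE x in lborel. norm (p_field p (weak_grad u x) \<bullet> weak_grad v x)
      \<le> norm (((p - 1) * norm (weak_grad u x) powr p + norm (weak_grad v x) powr p) / p)"
    using p_field_young[OF p] p by (intro AE_I2) (simp add: abs_of_nonneg pos_le_divide_eq mult.commute)
qed

lemma p_form_linear:
  fixes u v w :: "real^'n \<Rightarrow> real"
  assumes u: "u \<in> D1p p" and v: "v \<in> D1p p" and w: "w \<in> D1p p" and p: "p > 1"
  shows "p_form p u (\<lambda>x. v x + c * w x) = p_form p u v + c * p_form p u w"
proof -
  have D: "(\<lambda>x. v x + c * w x) \<in> D1p p" using v w p by (intro D1p_linear) auto
  note [measurable] = weak_grad_measurable[OF u] weak_grad_measurable[OF v] weak_grad_measurable[OF w]
    weak_grad_measurable[OF D]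
  have "AE x in lborel. weak_grad (\<lambda>x. v x + c * w x) x = weak_grad v x + c *\<^sub>R weak_grad w x"
    using v w p by (intro weak_grad_linear) auto
  then have "AE x in lborel. p_field p (weak_grad u x) \<bullet> weak_grad (\<lambda>x. v x + c * w x) x
      = p_field p (weak_grad u x) \<bullet> weak_grad v x + c * (p_field p (weak_grad u x) \<bullet> weak_grad w x)"
    by eventually_elim (simp add: inner_add_right)
  then have "p_form p u (\<lambda>x. v x + c * w x) = (LINT x|lborel. p_field p (weak_grad u x) \<bullet> weak_grad v x
      + c * (p_field p (weak_grad u x) \<bullet> weak_grad w x))"
    unfolding p_form_def by (intro integral_cong_AE) auto
  then show ?thesis
    using p_form_integrable[OF u v p] p_form_integrable[OF u w p] by (simp add: p_form_def)
qed

lemma p_form_self: "p_form p u u = dirichlet_energy p u"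
  by (simp add: p_form_def p_field_inner_self dirichlet_energy_def)

lemma p_form_young:
  fixes u v :: "real^'n \<Rightarrow> real"
  assumes u: "u \<in> D1p p" and v: "v \<in> D1p p" and p: "p > 1"
  shows "p * p_form p u v \<le> (p - 1) * dirichlet_energy p u + dirichlet_energy p v"
proof -
  note int = weak_grad_powr_integrable[OF u] weak_grad_powr_integrable[OF v]
  have "p * p_form p u v = (LINT x|lborel. p * (p_field p (weak_grad u x) \<bullet> weak_grad v x))"
    by (simp add: p_form_def)
  also have "\<dots> \<le> (LINT x|lborel. (p - 1) * norm (weak_grad u x) powr p + norm (weak_grad v x) powr p)"
  proof (rule integral_mono)
    fix x
    have "p * (p_field p (weak_grad u x) \<bullet> weak_grad v x) \<le> p * \<bar>p_field p (weak_grad u x) \<bullet> weak_grad v x\<bar>"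
      using p by (intro mult_left_mono) auto
    then show "p * (p_field p (weak_grad u x) \<bullet> weak_grad v x)
        \<le> (p - 1) * norm (weak_grad u x) powr p + norm (weak_grad v x) powr p"
      using p_field_young[OF p] order_trans by blast
  qed (use int p_form_integrable[OF u v p] p in auto)
  also have "\<dots> = (p - 1) * dirichlet_energy p u + dirichlet_energy p v"
    using int p by (simp add: dirichlet_energy_def)
  finally show ?thesis .
qed

lemma grad_norm_le_iff:
  assumes "p > 0"
  shows "grad_norm p u \<le> grad_norm p v \<longleftrightarrow> dirichlet_energy p u \<le> dirichlet_energy p v"
proof
  assume "grad_norm p u \<le> grad_norm p v"
  then have "grad_norm p u powr p \<le> grad_norm p v powr p"
    using assms by (intro powr_mono2) (auto simp: grad_norm_eq)
  then show "dirichlet_energy p u \<le> dirichlet_energy p v"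
    using assms by (simp add: grad_norm_eq powr_powr dirichlet_energy_nonneg)
next
  assume "dirichlet_energy p u \<le> dirichlet_energy p v"
  then show "grad_norm p u \<le> grad_norm p v"
    unfolding grad_norm_eq using assms by (intro powr_mono2) (auto simp: dirichlet_energy_nonneg)
qed

text \<open>Dominated convergence, with \<open>p_field\<close> continuous also at 0. The integrands
  are rewritten almost everywhere first, because the gradient of the perturbed function is known
  only up to a null set for each k.\<close>

lemma p_form_tendsto:
  fixes u w :: "real^'n \<Rightarrow> real"
  assumes u: "u \<in> D1p p" and w: "w \<in> D1p p" and p: "p > 1"
  shows "(\<lambda>k. p_form p (\<lambda>x. u x + inverse (real (Suc k)) * w x) w) \<longlonglongrightarrow> p_form p u w"
proof -
  define t where "t k = inverse (real (Suc k))" for k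
  have t: "t \<longlonglongrightarrow> 0" "\<And>k. \<bar>t k\<bar> \<le> 1"
    unfolding t_def by (rule LIMSEQ_inverse_real_of_nat) (simp add: inverse_le_1_iff)
  note [measurable] = weak_grad_measurable[OF u] weak_grad_measurable[OF w]
  have D: "(\<lambda>x. u x + t k * w x) \<in> D1p p" for k
    using u w p by (intro D1p_linear) auto
  note [measurable] = weak_grad_measurable[OF D]
  have "p_form p (\<lambda>x. u x + t k * w x) w
      = (LINT x|lborel. p_field p (weak_grad u x + t k *\<^sub>R weak_grad w x) \<bullet> weak_grad w x)" for k
  proof -
    have "AE x in lborel. weak_grad (\<lambda>x. u x + t k * w x) x = weak_grad u x + t k *\<^sub>R weak_grad w x"
      using u w p by (intro weak_grad_linear) auto
    then have "AE x in lborel. p_field p (weak_grad (\<lambda>x. u x + t k * w x) x) \<bullet> weak_grad w x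
        = p_field p (weak_grad u x + t k *\<^sub>R weak_grad w x) \<bullet> weak_grad w x"
      by eventually_elim simp
    then show ?thesis
      unfolding p_form_def by (intro integral_cong_AE) auto
  qed
  moreover have "(\<lambda>k. LINT x|lborel. p_field p (weak_grad u x + t k *\<^sub>R weak_grad w x) \<bullet> weak_grad w x)
      \<longlonglongrightarrow> (LINT x|lborel. p_field p (weak_grad u x) \<bullet> weak_grad w x)"
  proof (rule integral_dominated_convergence)
    \<comment> \<open>The right side of \<open>p_field_young\<close> for a + t b and b, divided by
      p, with |a + t b|^p replaced by 2^p (|a|^p + |b|^p). This is independent of k because |t| <=
      1.\<close>
    define W where "W x = ((p - 1) * (2 powr p * (norm (weak_grad u x) powr p + norm (weak_grad w x) powr p))
        + norm (weak_grad w x) powr p) / p" for x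
    show "integrable lborel W"
      unfolding W_def using weak_grad_powr_integrable[OF u] weak_grad_powr_integrable[OF w] p by simp
    have "(\<lambda>k. p_field p (weak_grad u x + t k *\<^sub>R weak_grad w x)) \<longlonglongrightarrow> p_field p (weak_grad u x)" for x
    proof (rule p_field_tendsto[OF p])
      have "(\<lambda>k. weak_grad u x + t k *\<^sub>R weak_grad w x) \<longlonglongrightarrow> weak_grad u x + 0 *\<^sub>R weak_grad w x"
        by (intro tendsto_intros t)
      then show "(\<lambda>k. weak_grad u x + t k *\<^sub>R weak_grad w x) \<longlonglongrightarrow> weak_grad u x" by simp
    qed
    then show "AE x in lborel. (\<lambda>k. p_field p (weak_grad u x + t k *\<^sub>R weak_grad w x) \<bullet> weak_grad w x)
        \<longlonglongrightarrow> p_field p (weak_grad u x) \<bullet> weak_grad w x"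
      by (intro AE_I2 tendsto_inner tendsto_const)
    show "AE x in lborel. norm (p_field p (weak_grad u x + t k *\<^sub>R weak_grad w x) \<bullet> weak_grad w x) \<le> W x" for k
    proof (rule AE_I2)
      fix x
      let ?a = "weak_grad u x" and ?b = "weak_grad w x"
      have "norm (?a + t k *\<^sub>R ?b) \<le> norm ?a + norm ?b"
        using norm_triangle_ineq[of ?a "t k *\<^sub>R ?b"] mult_right_mono[OF t(2)[of k], of "norm ?b"] by simp
      then have "norm (?a + t k *\<^sub>R ?b) powr p \<le> (norm ?a + norm ?b) powr p"
        using p by (intro powr_mono2) auto
      also have "\<dots> \<le> 2 powr p * (norm ?a powr p + norm ?b powr p)"
        using p by (intro powr_add_le) auto
      finally have "(p - 1) * norm (?a + t k *\<^sub>R ?b) powr p \<le> (p - 1) * (2 powr p * (norm ?a powr p + norm ?b powr p))"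
        using p by (intro mult_left_mono) auto
      with p_field_young[OF p, of "?a + t k *\<^sub>R ?b" ?b]
      have "p * \<bar>p_field p (?a + t k *\<^sub>R ?b) \<bullet> ?b\<bar>
          \<le> (p - 1) * (2 powr p * (norm ?a powr p + norm ?b powr p)) + norm ?b powr p" by linarith
      then show "norm (p_field p (?a + t k *\<^sub>R ?b) \<bullet> ?b) \<le> W x"
        using p by (simp add: W_def pos_le_divide_eq mult.commute)
    qed
  qed measurable
  ultimately show ?thesis by (simp add: p_form_def t_def)
qed

text \<open>Convexity replaces differentiation of the energy: Young's inequality bounds the energy
  increment from u to u + t w by a multiple of the form at u + t w.\<close>
lemma minimizer_p_form_nonneg:
  fixes u w :: "real^'n \<Rightarrow> real"
  assumes u: "u \<in> D1p p" and w: "w \<in> D1p p" and p: "p > 1"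
    and min: "\<And>t. dirichlet_energy p u \<le> dirichlet_energy p (\<lambda>x. u x + t * w x)"
  shows "p_form p u w \<ge> 0"
proof (rule LIMSEQ_le_const[OF p_form_tendsto[OF u w p]], intro exI allI impI)
  fix k
  define t where "t = inverse (real (Suc k))"
  define v where "v x = u x + t * w x" for x
  have t: "t > 0" by (simp add: t_def)
  have v: "v \<in> D1p p" unfolding v_def using u w p by (intro D1p_linear) auto
  \<comment> \<open>Writing u as v - t w, Young's inequality for the form at v against u becomes
    E(v) - E(u) <= p t times the form at v against w, where E is the energy. Minimality makes the
    left side nonnegative.\<close>
  have "p_form p v u = p_form p v (\<lambda>x. v x + (- t) * w x)"
    by (simp add: v_def)
  also have "\<dots> = dirichlet_energy p v + (- t) * p_form p v w"
    by (simp only: p_form_linear[OF v v w p] p_form_self)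
  finally have "p * (dirichlet_energy p v - t * p_form p v w) \<le> (p - 1) * dirichlet_energy p v + dirichlet_energy p u"
    using p_form_young[OF v u p] by simp
  then have "dirichlet_energy p v - dirichlet_energy p u \<le> p * t * p_form p v w"
    by (simp add: algebra_simps)
  then have "0 \<le> p * t * p_form p v w"
    using min[of t] unfolding v_def[symmetric] by linarith
  moreover have "p * t > 0" using p t by simp
  ultimately show "0 \<le> p_form p (\<lambda>x. u x + inverse (real (Suc k)) * w x) w"
    using p t unfolding v_def t_def[symmetric] by (metis not_less zero_le_mult_iff)
qed

text \<open>The measure enters only through the linearity of its integral on \<open>D1p\<close>.
  What remains is convexity of the energy and the fact that a linear form vanishing on the kernel of
  another is a multiple of it.\<close>

lemma p_laplace_eq_iff_minimizer:
  fixes u :: "real^'n \<Rightarrow> real"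
  assumes u: "u \<in> D1p p" and p: "p > 1"
    and L: "\<And>v w c. v \<in> D1p p \<Longrightarrow> w \<in> D1p p \<Longrightarrow>
      signed_integral \<mu> (\<lambda>x. v x + c * w x) = signed_integral \<mu> v + c * signed_integral \<mu> w"
  shows "(\<exists>c. p_laplace_eq p u c \<mu>) \<longleftrightarrow>
    (\<forall>v\<in>D1p p. signed_integral \<mu> v = signed_integral \<mu> u \<longrightarrow> grad_norm p u \<le> grad_norm p v)"
proof
  assume "\<exists>c. p_laplace_eq p u c \<mu>"
  then obtain c where c: "\<And>v. v \<in> D1p p \<Longrightarrow> p_form p u v = c * signed_integral \<mu> v"
    by (auto simp: p_laplace_eq_iff)
  show "\<forall>v\<in>D1p p. signed_integral \<mu> v = signed_integral \<mu> u \<longrightarrow> grad_norm p u \<le> grad_norm p v"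
  proof (intro ballI impI)
    fix v assume v: "v \<in> D1p p" "signed_integral \<mu> v = signed_integral \<mu> u"
    \<comment> \<open>The equation sees v only through its integral, which is that of u. Young's
      inequality then reads p E(u) <= (p - 1) E(u) + E(v).\<close>
    have "p_form p u v = dirichlet_energy p u"
      using c[OF u] c[OF v(1)] v(2) by (simp add: p_form_self)
    then have "dirichlet_energy p u \<le> dirichlet_energy p v"
      using p_form_young[OF u v(1) p] by (simp add: algebra_simps)
    then show "grad_norm p u \<le> grad_norm p v"
      using p by (simp add: grad_norm_le_iff)
  qed
next
  assume min: "\<forall>v\<in>D1p p. signed_integral \<mu> v = signed_integral \<mu> u \<longrightarrow> grad_norm p u \<le> grad_norm p v"
  have nonneg: "p_form p u w \<ge> 0" if w: "w \<in> D1p p" "signed_integral \<mu> w = 0" for w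
  proof (rule minimizer_p_form_nonneg[OF u w(1) p])
    fix t
    have "(\<lambda>x. u x + t * w x) \<in> D1p p" using u w p by (intro D1p_linear) auto
    then show "dirichlet_energy p u \<le> dirichlet_energy p (\<lambda>x. u x + t * w x)"
      using min L[OF u w(1), of t] w(2) p by (simp add: grad_norm_le_iff)
  qed
  have zero: "p_form p u w = 0" if w: "w \<in> D1p p" "signed_integral \<mu> w = 0" for w
  proof -
    \<comment> \<open>This function is -w, written as one of the combinations v + c w for which
      linearity is available; it reverses the sign of the form.\<close>
    have "(\<lambda>x. w x + (- 2) * w x) \<in> D1p p" using w p by (intro D1p_linear) auto
    moreover have "signed_integral \<mu> (\<lambda>x. w x + (- 2) * w x) = 0"
      using L[OF w(1) w(1), of "- 2"] w(2) by simp
    ultimately have "p_form p u (\<lambda>x. w x + (- 2) * w x) \<ge> 0" by (rule nonneg)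
    then have "p_form p u w \<le> 0"
      unfolding p_form_linear[OF u w(1) w(1) p] by simp
    then show ?thesis using nonneg[OF w] by simp
  qed
  show "\<exists>c. p_laplace_eq p u c \<mu>"
  proof (cases "\<exists>w\<in>D1p p. signed_integral \<mu> w \<noteq> 0")
    case True
    then obtain w where w: "w \<in> D1p p" "signed_integral \<mu> w \<noteq> 0" by blast
    have "p_form p u v = p_form p u w / signed_integral \<mu> w * signed_integral \<mu> v" if v: "v \<in> D1p p" for v
    proof -
      \<comment> \<open>Chosen so that v + s w has integral 0; the vanishing of the form there
        determines its value at v.\<close>
      define s where "s = - (signed_integral \<mu> v / signed_integral \<mu> w)"
      have "(\<lambda>x. v x + s * w x) \<in> D1p p" using v w p by (intro D1p_linear) auto
      moreover have "signed_integral \<mu> (\<lambda>x. v x + s * w x) = 0"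
        unfolding L[OF v w(1)] using w(2) by (simp add: s_def)
      ultimately have "p_form p u (\<lambda>x. v x + s * w x) = 0" by (rule zero)
      then show ?thesis
        unfolding p_form_linear[OF u v w(1) p] by (simp add: s_def)
    qed
    then show ?thesis unfolding p_laplace_eq_iff by blast
  next
    case False
    \<comment> \<open>Here every function has integral 0, so the form vanishes identically and any c
      solves the equation.\<close>
    then show ?thesis using zero by (auto simp: p_laplace_eq_iff)
  qed
qed

section \<open>The Morrey constant\<close>

lemma push_forward_comp: "push_forward S (push_forward T \<rho>) = push_forward (\<lambda>x. S (T x)) \<rho>"
  by (simp add: push_forward_def vimage_def)

text \<open>If all test functions had integral 0, the Jordan parts would coincide and the first
  moment would vanish, which admissibility excludes.\<close>

lemma signed_integral_test_function_nonzero: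
  fixes \<mu> :: "(real^'n) set \<Rightarrow> real"
  assumes "admissible \<mu>"
  obtains \<phi> where "\<phi> \<in> test_functions" "signed_integral \<mu> \<phi> \<noteq> 0"
proof -
  have "\<exists>\<phi>\<in>test_functions. signed_integral \<mu> \<phi> \<noteq> 0"
  proof (rule ccontr)
    assume "\<not> ?thesis"
    then have eq: "(LINT x|positive_part \<mu>. \<phi> x) = (LINT x|negative_part \<mu>. \<phi> x)" if "\<phi> \<in> test_functions" for \<phi>
      using that by (simp add: signed_integral_def)
    have fin: "finite_measure (positive_part \<mu>)" "finite_measure (negative_part \<mu>)"
      using assms by (auto simp: admissible_def intro: finite_measure_positive_part finite_measure_negative_part)
    have "positive_part \<mu> = negative_part \<mu>"
      using eq fin by (intro measure_eqI_test_functions) (auto simp: finite_measure.emeasure_finite less_top[symmetric])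
    then have "signed_integral \<mu> (\<lambda>y. y) = 0" by (simp add: signed_integral_def)
    then show False using assms by (simp add: admissible_def)
  qed
  then show thesis using that by blast
qed

lemma morrey_ratio_le_seminorm:
  "S \<in> similarities \<Longrightarrow> ennreal (morrey_ratio p (push_forward S \<rho>) u) \<le> morrey_seminorm p \<rho> u"
  unfolding morrey_seminorm_def by (rule SUP_upper)

lemma morrey_seminorm_const:
  fixes \<rho> :: "(real^'n) set \<Rightarrow> real"
  assumes "admissible \<rho>"
  shows "morrey_seminorm p \<rho> (\<lambda>x. c) = 0"
proof -
  have "signed_integral (push_forward S \<rho>) (\<lambda>x. c) = 0" if "S \<in> similarities" for S
    using admissible_push_forward[OF assms that]
    by (intro signed_integral_const) (auto simp: admissible_def)
  then have "morrey_seminorm p \<rho> (\<lambda>x. c) = (SUP S\<in>(similarities :: (real^'n \<Rightarrow> real^'n) set). 0)"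
    unfolding morrey_seminorm_def by (intro SUP_cong) (auto simp: morrey_ratio_def)
  then show ?thesis by (metis SUP_bot bot_ennreal)
qed

text \<open>\<open>LEAST\<close> is informative only if a minimum exists, so the infimum of the
  valid constants must itself be shown valid. For positive gradient norm one divides by it; for
  gradient norm 0 the function is constant and the left side is 0.\<close>

lemma morrey_constant_least:
  fixes \<rho> :: "(real^'n) set \<Rightarrow> real"
  assumes \<rho>: "admissible \<rho>" and p: "real CARD('n) < p"
  shows morrey_constant_le: "(\<And>u. u \<in> D1p p \<Longrightarrow> morrey_seminorm p \<rho> u \<le> C * ennreal (grad_norm p u)) \<Longrightarrow>
      morrey_constant p \<rho> \<le> C"
    and morrey_inequality: "u \<in> D1p p \<Longrightarrow>
      morrey_seminorm p \<rho> u \<le> morrey_constant p \<rho> * ennreal (grad_norm p u)"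
proof -
  define A where "A = {C. \<forall>u\<in>D1p p. morrey_seminorm p \<rho> u \<le> C * ennreal (grad_norm p u)}"
  have const: "morrey_seminorm p \<rho> u = 0" if "u \<in> D1p p" "grad_norm p u = 0" for u
    by (subst grad_norm_eq_0_imp_const[OF that(1) p that(2)]) (rule morrey_seminorm_const[OF \<rho>])
  have Inf_A: "\<forall>u\<in>D1p p. morrey_seminorm p \<rho> u \<le> Inf A * ennreal (grad_norm p u)"
  proof
    fix u :: "real^'n \<Rightarrow> real" assume u: "u \<in> D1p p"
    show "morrey_seminorm p \<rho> u \<le> Inf A * ennreal (grad_norm p u)"
    proof (cases "grad_norm p u = 0")
      case True
      then show ?thesis using const[OF u] by simp
    next
      case False
      then have g: "grad_norm p u > 0" by (simp add: grad_norm_eq order_less_le)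
      have "morrey_seminorm p \<rho> u / ennreal (grad_norm p u) \<le> Inf A"
        using u g by (intro Inf_greatest divide_le_posI_ennreal) (auto simp: A_def mult.commute)
      then have "morrey_seminorm p \<rho> u / ennreal (grad_norm p u) * ennreal (grad_norm p u) \<le> Inf A * ennreal (grad_norm p u)"
        by (rule mult_right_mono) simp
      then show ?thesis
        using g by (simp add: ennreal_divide_times divide_eq_1_ennreal)
    qed
  qed
  have "morrey_constant p \<rho> = Inf A"
    unfolding morrey_constant_def
  proof (rule Least_equality)
    show "\<forall>u\<in>D1p p. morrey_seminorm p \<rho> u \<le> Inf A * ennreal (grad_norm p u)"
      by (rule Inf_A)
    show "Inf A \<le> C" if "\<forall>u\<in>D1p p. morrey_seminorm p \<rho> u \<le> C * ennreal (grad_norm p u)" for C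
      using that by (intro Inf_lower) (simp add: A_def)
  qed
  moreover have "C \<in> A" if "\<And>u. u \<in> D1p p \<Longrightarrow> morrey_seminorm p \<rho> u \<le> C * ennreal (grad_norm p u)"
    using that by (simp add: A_def)
  ultimately show "(\<And>u. u \<in> D1p p \<Longrightarrow> morrey_seminorm p \<rho> u \<le> C * ennreal (grad_norm p u)) \<Longrightarrow>
      morrey_constant p \<rho> \<le> C"
    by (simp add: Inf_lower)
  show "u \<in> D1p p \<Longrightarrow> morrey_seminorm p \<rho> u \<le> morrey_constant p \<rho> * ennreal (grad_norm p u)"
    using Inf_A unfolding \<open>morrey_constant p \<rho> = Inf A\<close> by blast
qed

text \<open>Every similarity factors through S, and both the Morrey ratio and the gradient norm of
  w o Q scale like the (1 - n/p)-th power of the ratio of Q. So a bound for one push forward of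
  the measure gives the same bound for all of them.\<close>
lemma morrey_seminorm_le:
  fixes \<rho> :: "(real^'n) set \<Rightarrow> real"
  assumes \<rho>: "admissible \<rho>" and p: "real CARD('n) < p" and S: "S \<in> similarities"
    and bound: "\<And>v. v \<in> D1p p \<Longrightarrow> morrey_ratio p (push_forward S \<rho>) v \<le> c * grad_norm p v"
    and w: "w \<in> D1p p"
  shows "morrey_seminorm p \<rho> w \<le> ennreal (c * grad_norm p w)"
  unfolding morrey_seminorm_def
proof (rule SUP_least)
  define \<mu> where "\<mu> = push_forward S \<rho>"
  have \<mu>: "admissible \<mu>" unfolding \<mu>_def by (rule admissible_push_forward[OF \<rho> S])
  fix T :: "real^'n \<Rightarrow> real^'n" assume T: "T \<in> similarities"
  obtain S' where S': "S' \<in> similarities" "\<And>x. S (S' x) = x" "\<And>x. S' (S x) = x"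
    using similarity_inverse[OF S] by blast
  \<comment> \<open>With Q equal to T after the inverse of S, pushing \<open>\<rho>\<close> by T is
    pushing \<open>\<mu>\<close> by Q, and the hypothesis \<open>bound\<close> is applied to w
    composed with Q.\<close>
  define Q where "Q x = T (S' x)" for x
  have Q: "Q \<in> similarities" unfolding Q_def by (rule similarity_comp[OF T S'(1)])
  obtain r R z where r: "r > 0" and R: "orthogonal_transformation R" and Qeq: "Q = (\<lambda>y. r *\<^sub>R R y + z)"
    by (rule similarityE[OF Q])
  have T\<rho>: "push_forward T \<rho> = push_forward Q \<mu>"
    by (simp add: \<mu>_def push_forward_comp Q_def S'(3))
  define \<alpha> where "\<alpha> = 1 - real CARD('n) / p"
  define m where "m = norm (signed_integral \<mu> (\<lambda>x. x))"
  have "morrey_ratio p (push_forward T \<rho>) w = \<bar>signed_integral \<mu> (\<lambda>x. w (Q x))\<bar> / (r * m) powr \<alpha>"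
    unfolding T\<rho> morrey_ratio_def \<alpha>_def m_def
    using \<mu> signed_integral_push_forward[OF _ Q D1p_continuous[OF w p], of \<mu>]
      signed_integral_push_forward_id[OF _ _ _ r R Qeq, of \<mu>]
    by (simp add: admissible_def)
  also have "\<dots> = morrey_ratio p \<mu> (\<lambda>x. w (Q x)) / r powr \<alpha>"
    by (simp add: morrey_ratio_def \<alpha>_def m_def powr_mult)
  also have "\<dots> \<le> c * grad_norm p (\<lambda>x. w (Q x)) / r powr \<alpha>"
    unfolding \<mu>_def by (intro divide_right_mono bound D1p_similarity(1)[OF w p r R Qeq]) auto
  also have "\<dots> = c * grad_norm p w"
    using r by (simp add: grad_norm_similarity[OF w p r R Qeq] \<alpha>_def)
  finally show "ennreal (morrey_ratio p (push_forward T \<rho>) w) \<le> ennreal (c * grad_norm p w)"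
    by (rule ennreal_leI)
qed

theorem theorem1p1:
  fixes p :: real
    and \<rho> \<mu> :: "(real^'n) set \<Rightarrow> real"
    and S :: "real^'n \<Rightarrow> real^'n"
    and u :: "real^'n \<Rightarrow> real"
  assumes "real CARD('n) < p"
    and "admissible \<rho>"
    and "S \<in> similarities"
    and "\<mu> = push_forward S \<rho>"
    and "u \<in> D1p p"
  shows "(extremal p \<rho> u \<and> morrey_seminorm p \<rho> u = ennreal (morrey_ratio p \<mu> u)
            \<longleftrightarrow> (\<exists>c. p_laplace_eq p u c \<mu>))
       \<and> ((\<exists>c. p_laplace_eq p u c \<mu>)
            \<longleftrightarrow> (\<forall>v\<in>D1p p. signed_integral \<mu> v = signed_integral \<mu> u \<longrightarrow>
                   grad_norm p u \<le> grad_norm p v))"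
proof -
  note p = assms(1) and \<rho> = assms(2) and S = assms(3) and \<mu>_eq = assms(4) and u = assms(5)
  have "real CARD('n) \<ge> 1" by (simp add: Suc_leI)
  then have p1: "p > 1" and p0: "p > 0" using p by linarith+
  have \<mu>: "admissible \<mu>" unfolding \<mu>_eq by (rule admissible_push_forward[OF \<rho> S])
  define L where "L = (signed_integral \<mu> :: (real^'n \<Rightarrow> real) \<Rightarrow> real)"
  define g where "g = (grad_norm p :: (real^'n \<Rightarrow> real) \<Rightarrow> real)"
  define m where "m = norm (signed_integral \<mu> (\<lambda>x. x)) powr (1 - real CARD('n) / p)"
  \<comment> \<open>A nonzero first moment survives every similarity, so the ratios below have a
    genuine denominator.\<close>
  have m: "m > 0" using \<mu> by (simp add: m_def admissible_def)
  have ratio: "morrey_ratio p \<mu> v = \<bar>L v\<bar> / m" for v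
    by (simp add: morrey_ratio_def L_def m_def)
  have g_nonneg: "g v \<ge> 0" for v by (simp add: g_def grad_norm_eq)
  have ratio_le: "ennreal (morrey_ratio p \<mu> v) \<le> morrey_seminorm p \<rho> v" for v
    unfolding \<mu>_eq by (rule morrey_ratio_le_seminorm[OF S])
  note inequality = morrey_inequality[OF \<rho> p, folded g_def]
  have linear: "signed_integral \<mu> (\<lambda>x. v x + c * w x) = signed_integral \<mu> v + c * signed_integral \<mu> w"
    if "v \<in> D1p p" "w \<in> D1p p" for v w c
  proof -
    have cont: "continuous_on UNIV v" "continuous_on UNIV w"
      using that p by (auto intro: D1p_continuous)
    then have cont': "continuous_on UNIV (\<lambda>x. c * w x)"
      by (intro continuous_intros)
    have "signed_integral \<mu> (\<lambda>x. c * w x) = c * signed_integral \<mu> w"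
      using \<mu> signed_integral_scaleR[of \<mu> w w c] cont by (simp add: admissible_def)
    then show ?thesis
      using \<mu> cont cont' signed_integral_add[of \<mu> v "\<lambda>x. c * w x"] by (simp add: admissible_def)
  qed
  have ii_iff_iii: "(\<exists>c. p_laplace_eq p u c \<mu>) \<longleftrightarrow> (\<forall>v\<in>D1p p. L v = L u \<longrightarrow> g u \<le> g v)"
    unfolding L_def g_def by (rule p_laplace_eq_iff_minimizer[OF u p1 linear])
  moreover have "extremal p \<rho> u \<and> morrey_seminorm p \<rho> u = ennreal (morrey_ratio p \<mu> u)
      \<longleftrightarrow> (\<forall>v\<in>D1p p. L v = L u \<longrightarrow> g u \<le> g v)" (is "?i \<longleftrightarrow> ?iii")
  proof
    assume i: ?i
    then have eq: "ennreal (morrey_ratio p \<mu> u) = morrey_constant p \<rho> * ennreal (g u)"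
      unfolding extremal_def g_def by metis
    obtain \<phi> where \<phi>: "\<phi> \<in> test_functions" "L \<phi> \<noteq> 0"
      using signed_integral_test_function_nonzero[OF \<mu>] unfolding L_def by blast
    have "0 < ennreal (morrey_ratio p \<mu> \<phi>)" using \<phi>(2) m by (simp add: ratio)
    also have "\<dots> \<le> morrey_constant p \<rho> * ennreal (g \<phi>)"
      using ratio_le inequality[OF test_function_D1p[OF \<phi>(1) p]] order_trans by blast
    finally have pos: "morrey_constant p \<rho> \<noteq> 0" by auto
    show ?iii
    proof (intro ballI impI)
      fix v assume v: "v \<in> D1p p" "L v = L u"
      \<comment> \<open>The left side is the ratio of u, which equals the ratio of v since the
        integrals agree; the ratio of v is bounded by its seminorm and hence by the right side.
        Positivity of the constant then permits cancellation when it is finite.\<close>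
      have le: "morrey_constant p \<rho> * ennreal (g u) \<le> morrey_constant p \<rho> * ennreal (g v)"
        using ratio_le[of v] inequality[OF v(1)] v(2) unfolding eq[symmetric] ratio by simp
      show "g u \<le> g v"
      proof (cases "morrey_constant p \<rho> = top")
        case True
        then have "ennreal (g u) = 0"
          using eq by (metis ennreal_mult_eq_top_iff ennreal_neq_top)
        then show ?thesis using g_nonneg[of u] g_nonneg[of v] by simp
      next
        case False
        then show ?thesis
          using le pos g_nonneg[of v] by (simp add: ennreal_mult_le_mult_iff)
      qed
    qed
  next
    assume iii: ?iii
    have key: "\<bar>L w\<bar> * g u \<le> \<bar>L u\<bar> * g w" if w: "w \<in> D1p p" for w
    proof (cases "L w = 0")
      case True
      then show ?thesis using g_nonneg by simp
    next
      case False
      \<comment> \<open>Scaling w by s turns it into a competitor of u, at the price of a factor |s|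
        in its gradient norm.\<close>
      define s where "s = L u / L w"
      have "L (\<lambda>x. s * w x) = L u"
        using linear[OF D1p_const(1)[OF p0, of 0] w, of s] False \<mu>
        by (simp add: L_def s_def signed_integral_const admissible_def)
      then have "g u \<le> \<bar>s\<bar> * g w"
        using iii D1p_cmult(1)[OF w p0] grad_norm_cmult[OF w p0] unfolding g_def by metis
      then show ?thesis using False by (simp add: s_def field_simps)
    qed
    show ?i
    \<comment> \<open>The constant \<open>c\<close> of the other case divides by g u. For g u = 0
      the function is constant, and the seminorm, the ratio and the constant times 0 are all 0, even
      if the constant is infinite.\<close>
    proof (cases "g u = 0")
      case True
      then have const: "u = (\<lambda>x. u 0)"
        unfolding g_def by (rule grad_norm_eq_0_imp_const[OF u p])
      have "morrey_seminorm p \<rho> u = 0"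
        using morrey_seminorm_const[OF \<rho>, of p "u 0"] const by simp
      moreover have "L u = 0"
        using \<mu> signed_integral_const[of \<mu> "u 0"] const by (simp add: L_def admissible_def)
      ultimately show ?thesis
        using u True by (simp add: extremal_def g_def ratio)
    next
      case False
      then have gu: "g u > 0" using g_nonneg[of u] by simp
      \<comment> \<open>The best constant if u is optimal. By \<open>key\<close> it is valid for
        \<open>\<mu>\<close> alone, and scaling extends it to all similarities, so it bounds the
        Morrey constant from above.\<close>
      define c where "c = morrey_ratio p \<mu> u / g u"
      have c: "c \<ge> 0" using gu m by (simp add: c_def ratio)
      have "morrey_ratio p \<mu> v \<le> c * grad_norm p v" if "v \<in> D1p p" for v
        using key[OF that] m gu by (simp add: c_def ratio g_def field_simps)
      then have "morrey_seminorm p \<rho> w \<le> ennreal c * ennreal (grad_norm p w)" if "w \<in> D1p p" for w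
        using morrey_seminorm_le[OF \<rho> p S _ that, of c] c g_nonneg
        by (simp add: \<mu>_eq g_def ennreal_mult)
      then have "morrey_constant p \<rho> \<le> ennreal c"
        by (rule morrey_constant_le[OF \<rho> p])
      then have "morrey_constant p \<rho> * ennreal (g u) \<le> ennreal c * ennreal (g u)"
        by (rule mult_right_mono) simp
      also have "\<dots> = ennreal (morrey_ratio p \<mu> u)"
        using c gu by (simp add: c_def flip: ennreal_mult)
      \<comment> \<open>The chain closes: the ratio of u is at most its seminorm, which is at most
        the Morrey constant times g u, which is at most the ratio again. All three are
        equal.\<close>
      finally show ?thesis
        using ratio_le[of u] inequality[OF u] u by (auto simp: extremal_def g_def)
    qed
  qed
  ultimately show ?thesis unfolding L_def g_def by blast
qed

end
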